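(* Let $A$ be a finite group of order $a$, and let $d_1=1,d_2,\ldots,d_s$ be the degrees of the irreducible representations of $A$ over a splitting field for $A$. Then for all $n\in\mathbb{N}$ with $n\ge a(a-1)$, all minimal tuples for $n$ are eligible, and the number of minimal tuples for $n$ depends only on the value of $n$ modulo $a$.
   Context: A splitting field for $A$ is a field whose characteristic does not divide $a=|A|$ and over which all irreducible $A$-modules are absolutely irreducible. Over a splitting field, let $M_1,\ldots,M_s$ be representatives of the isomorphism classes of irreducible $A$-modules, with $M_1$ the trivial module, and let $d_i=\dim M_i$. The number $s$ and the degrees $d_i$ are the same for any splitting field, $d_1=1$, and $a=\sum_{i=1}^s d_i^2$. For a non-negative integer $n$, a tuple $(n_1,\ldots,n_s)$ of integers (not necessarily non-negative) is admissible for $n$ if $\sum_{i=1}^s n_id_i=n$. An admissible tuple is eligible if in addition $n_i\ge 0$ for all $i$. An admissible tuple for $n$ is a minimal tuple for $n$ if $\sum_{i=1}^s n_i^2$ is minimal amongst all admissible tuples for $n$. *)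

theory Defs
  imports
    "Jordan_Normal_Form.VS_Connect"
    "HOL-Algebra.Algebraic_Closure_Type"
    "HOL-Library.FuncSet"
begin

text \<open>
  Finite-dimensional modules for a group \<open>A\<close> over the field \<open>'k\<close> are given as matrix
  representations, that is, as homomorphisms from \<open>A\<close> to the group \<open>GL\<^sub>d('k)\<close> of units of the
  matrix ring. The values of such a function outside the carrier of \<open>A\<close> are irrelevant. Irreducible
  modules of a finite group are finite-dimensional, so nothing is lost.
\<close>

definition matrix_rep :: "('g, 'm) monoid_scheme \<Rightarrow> nat \<Rightarrow> ('g \<Rightarrow> 'k::field mat) \<Rightarrow> bool" where
  "matrix_rep A d \<rho> \<longleftrightarrow> \<rho> \<in> hom A (units_of (ring_mat TYPE('k) d ()))"

definition irreducible_rep :: "('g, 'm) monoid_scheme \<Rightarrow> nat \<Rightarrow> ('g \<Rightarrow> 'k::field mat) \<Rightarrow> bool" where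
  "irreducible_rep A d \<rho> \<longleftrightarrow>
     matrix_rep A d \<rho> \<and> d > 0 \<and>
     (\<forall>W. VectorSpace.subspace class_ring W (module_vec TYPE('k) d) \<and>
          (\<forall>g \<in> carrier A. \<forall>w \<in> W. \<rho> g *\<^sub>v w \<in> W) \<longrightarrow>
          W = {0\<^sub>v d} \<or> W = carrier_vec d)"

text \<open>
  \<open>similar_mat_wit\<close> says that \<open>P\<close> and \<open>Q\<close> are mutually inverse square matrices with
  \<open>\<rho> g = P * \<sigma> g * Q\<close>; one pair \<open>P\<close>, \<open>Q\<close> has to work for all \<open>g\<close>.
\<close>

definition isomorphic_rep :: "('g, 'm) monoid_scheme \<Rightarrow> ('g \<Rightarrow> 'k::field mat) \<Rightarrow> ('g \<Rightarrow> 'k mat) \<Rightarrow> bool" where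
  "isomorphic_rep A \<rho> \<sigma> \<longleftrightarrow> (\<exists>P Q. \<forall>g \<in> carrier A. similar_mat_wit (\<rho> g) (\<sigma> g) P Q)"

text \<open>
  Absolute irreducibility is irreducibility after extension of scalars to an algebraic closure. This
  is equivalent to irreducibility after every field extension, over which one cannot quantify
  inside a formula when fields are types.
\<close>

definition absolutely_irreducible_rep ::
    "('g, 'm) monoid_scheme \<Rightarrow> nat \<Rightarrow> ('g \<Rightarrow> 'k::field mat) \<Rightarrow> bool" where
  "absolutely_irreducible_rep A d \<rho> \<longleftrightarrow> irreducible_rep A d (\<lambda>g. map_mat to_ac (\<rho> g))"

text \<open>In characteristic \<open>0\<close> the first condition holds since \<open>card (carrier A) \<noteq> 0\<close> for finite \<open>A\<close>.\<close>

definition splitting_field :: "'k::field itself \<Rightarrow> ('g, 'm) monoid_scheme \<Rightarrow> bool" where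
  "splitting_field _ A \<longleftrightarrow>
     \<not> CHAR('k) dvd card (carrier A) \<and>
     (\<forall>d (\<rho> :: 'g \<Rightarrow> 'k mat). irreducible_rep A d \<rho> \<longrightarrow> absolutely_irreducible_rep A d \<rho>)"

definition irreducible_representatives ::
    "('g, 'm) monoid_scheme \<Rightarrow> nat \<Rightarrow> (nat \<Rightarrow> nat) \<Rightarrow> (nat \<Rightarrow> 'g \<Rightarrow> 'k::field mat) \<Rightarrow> bool" where
  "irreducible_representatives A s d M \<longleftrightarrow>
     (\<forall>i \<in> {1..s}. irreducible_rep A (d i) (M i)) \<and>
     (\<forall>i \<in> {1..s}. \<forall>j \<in> {1..s}. isomorphic_rep A (M i) (M j) \<longrightarrow> i = j) \<and>
     (\<forall>e (\<rho> :: 'g \<Rightarrow> 'k mat). irreducible_rep A e \<rho> \<longrightarrow> (\<exists>i \<in> {1..s}. isomorphic_rep A \<rho> (M i))) \<and>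
     (\<forall>g \<in> carrier A. M 1 g = 1\<^sub>m 1)"

text \<open>
  A tuple \<open>(n\<^sub>1, \<dots>, n\<^sub>s)\<close> is a function that is \<open>undefined\<close> outside \<open>{1..s}\<close>, so that
  distinct functions are distinct tuples.
\<close>

definition admissible :: "nat \<Rightarrow> (nat \<Rightarrow> nat) \<Rightarrow> nat \<Rightarrow> (nat \<Rightarrow> int) \<Rightarrow> bool" where
  "admissible s d n t \<longleftrightarrow> t \<in> {1..s} \<rightarrow>\<^sub>E UNIV \<and> (\<Sum>i=1..s. t i * int (d i)) = int n"

definition eligible :: "nat \<Rightarrow> (nat \<Rightarrow> nat) \<Rightarrow> nat \<Rightarrow> (nat \<Rightarrow> int) \<Rightarrow> bool" where
  "eligible s d n t \<longleftrightarrow> admissible s d n t \<and> (\<forall>i \<in> {1..s}. t i \<ge> 0)"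

definition minimal_tuple :: "nat \<Rightarrow> (nat \<Rightarrow> nat) \<Rightarrow> nat \<Rightarrow> (nat \<Rightarrow> int) \<Rightarrow> bool" where
  "minimal_tuple s d n t \<longleftrightarrow> is_arg_min (\<lambda>t. \<Sum>i=1..s. (t i)\<^sup>2) (admissible s d n) t"

end

theory Submission
  imports Defs "Jordan_Normal_Form.Char_Poly"
begin

text \<open>
  Because the squares of the degrees sum to \<open>a\<close>, adding the vector \<open>(d\<^sub>1, \<dots>, d\<^sub>s)\<close> to a tuple
  changes \<open>n\<close> to \<open>n + a\<close> and the sum of squares by a constant that depends only on \<open>n\<close>, so it maps
  minimal tuples to minimal tuples. Comparing a minimal tuple with its translates by the vectors
  \<open>\<plusminus>(d\<^sub>j e\<^sub>1 - e\<^sub>j)\<close> shows that \<open>t\<^sub>j\<close> is within \<open>(1 + d\<^sub>j\<^sup>2) / 2\<close> of \<open>d\<^sub>j t\<^sub>1\<close>. Together with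
  \<open>n \<ge> a (a - 1)\<close> this gives \<open>2 t\<^sub>1 \<ge> a - 1 \<ge> d\<^sub>j\<close> for \<open>j \<ge> 2\<close>, hence \<open>2 t\<^sub>j \<ge> - 1\<close>.

  For the sum of the squares, consider the functions on \<open>A\<close> given by the matrix entries of the \<open>M\<^sub>i\<close>.
  By Schur orthogonality they are linearly independent, so there are at most \<open>a\<close> of them. If there
  were fewer, some \<open>f \<noteq> 0\<close> would annihilate all of them, i.e. \<open>\<Sum>\<^sub>g f(g) g\<close> would act as \<open>0\<close> on every
  irreducible module, hence with trace \<open>0\<close> on every module, because traces are additive along
  invariant subspaces. On the regular module the trace is \<open>a f(1)\<close>, and translates of \<open>f\<close> give
  \<open>a f(h) = 0\<close> for all \<open>h\<close>.
\<close>

section \<open>Matrices\<close>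

text \<open>Gaussian elimination, by induction on the set \<open>J\<close> of equations; the
  unknowns are the values of \<open>f\<close> on \<open>I\<close>. If some coefficient
  \<open>F i0 j\<close> is nonzero, \<open>i0\<close> serves as pivot for equation \<open>j\<close>
  and is removed from the unknowns.\<close>

lemma nonzero_combination_exists:
  fixes F :: "'i \<Rightarrow> 'j \<Rightarrow> 'k::field"
  assumes "finite J" "finite I" "card J < card I"
  shows "\<exists>f. (\<exists>i\<in>I. f i \<noteq> 0) \<and> (\<forall>j\<in>J. (\<Sum>i\<in>I. f i * F i j) = 0)"
  using assms
proof (induction J arbitrary: I F rule: finite_induct)
  case empty
  then have "I \<noteq> {}" by auto
  then show ?case by (intro exI[of _ "\<lambda>_. 1"]) auto
next
  case (insert j J)
  show ?case
  proof (cases "\<forall>i\<in>I. F i j = 0")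
    case True
    have "\<exists>f. (\<exists>i\<in>I. f i \<noteq> 0) \<and> (\<forall>j\<in>J. (\<Sum>i\<in>I. f i * F i j) = 0)"
      using insert by simp
    with True show ?thesis by auto
  next
    case False
    then obtain i0 where i0: "i0 \<in> I" "F i0 j \<noteq> 0" by blast
    define I' where "I' = I - {i0}"
    have fin: "finite I'" and I: "I = insert i0 I'" and i0': "i0 \<notin> I'"
      using insert i0 by (auto simp: I'_def)
    have "card J < card I'"
      using insert i0 by (simp add: I'_def)
    \<comment> \<open>Subtracting \<open>F i j / F i0 j\<close> times row \<open>i0\<close> clears
      column \<open>j\<close>; \<open>c\<close> below is the value at \<open>i0\<close> that
      equation \<open>j\<close> then forces.\<close>
    from insert.IH[OF fin this, of "\<lambda>i j'. F i j' - F i j / F i0 j * F i0 j'"]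
    obtain f where f: "\<exists>i\<in>I'. f i \<noteq> 0"
      "\<And>j'. j' \<in> J \<Longrightarrow> (\<Sum>i\<in>I'. f i * (F i j' - F i j / F i0 j * F i0 j')) = 0" by blast
    define c where "c = - (\<Sum>i\<in>I'. f i * F i j) / F i0 j"
    define f' where "f' = f(i0 := c)"
    have sum_f': "(\<Sum>i\<in>I. f' i * F i j') = c * F i0 j' + (\<Sum>i\<in>I'. f i * F i j')" for j'
    proof -
      have "(\<Sum>i\<in>I'. f' i * F i j') = (\<Sum>i\<in>I'. f i * F i j')"
        using i0' by (intro sum.cong) (auto simp: f'_def)
      then show ?thesis using fin i0' by (simp add: I f'_def)
    qed
    have "(\<Sum>i\<in>I. f' i * F i j) = 0"
      using i0 unfolding sum_f' by (simp add: c_def)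
    moreover have "(\<Sum>i\<in>I. f' i * F i j') = 0" if "j' \<in> J" for j'
    proof -
      have "c * F i0 j' = - (\<Sum>i\<in>I'. f i * (F i j / F i0 j * F i0 j'))"
        by (simp add: c_def sum_distrib_right sum_divide_distrib sum_negf mult.assoc)
      then show ?thesis
        using f(2)[OF that] unfolding sum_f' by (simp add: right_diff_distrib sum_subtractf)
    qed
    moreover have "\<exists>i\<in>I. f' i \<noteq> 0"
      using f(1) i0' by (auto simp: I f'_def)
    ultimately show ?thesis by blast
  qed
qed

text \<open>If \<open>J\<close> were larger than \<open>I\<close>, the rows of \<open>Y\<close>
  would satisfy a nontrivial relation \<open>f\<close>; multiplying it by a column \<open>j'\<close>
  of \<open>F\<close> leaves \<open>f j' = 0\<close>. The index sets are arbitrary, so this serves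
  both for matrices and for the family of all matrix coefficients.\<close>

lemma card_le_of_left_inverse:
  fixes Y :: "'j \<Rightarrow> 'i \<Rightarrow> 'k::field"
  assumes "finite I" "finite J"
    and inv: "\<And>j j'. j \<in> J \<Longrightarrow> j' \<in> J \<Longrightarrow> (\<Sum>i\<in>I. Y j i * F i j') = (if j = j' then 1 else 0)"
  shows "card J \<le> card I"
proof (rule ccontr)
  assume "\<not> card J \<le> card I"
  with assms nonzero_combination_exists[of I J Y] obtain f j' where
    f: "j' \<in> J" "f j' \<noteq> 0" "\<And>i. i \<in> I \<Longrightarrow> (\<Sum>j\<in>J. f j * Y j i) = 0" by auto
  have "0 = (\<Sum>i\<in>I. (\<Sum>j\<in>J. f j * Y j i) * F i j')"
    using f by simp
  also have "\<dots> = (\<Sum>j\<in>J. f j * (\<Sum>i\<in>I. Y j i * F i j'))"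
    unfolding sum_distrib_left sum_distrib_right mult.assoc by (rule sum.swap)
  also have "\<dots> = (\<Sum>j\<in>J. if j = j' then f j else 0)"
    using inv f by (intro sum.cong) auto
  also have "\<dots> = f j'"
    using f assms by simp
  finally show False using f by simp
qed

lemma mat_one_le_dim:
  fixes A B :: "'k::field mat"
  assumes "A \<in> carrier_mat n m" "B \<in> carrier_mat m n" "A * B = 1\<^sub>m n"
  shows "n \<le> m"
proof -
  have "(\<Sum>k\<in>{0..<m}. A $$ (i, k) * B $$ (k, j)) = (if i = j then 1 else 0)" if "i < n" "j < n" for i j
  proof -
    have "(A * B) $$ (i, j) = (if i = j then 1 else 0)"
      using that by (simp add: assms(3))
    moreover have "(A * B) $$ (i, j) = (\<Sum>k\<in>{0..<m}. A $$ (i, k) * B $$ (k, j))"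
      using assms(1,2) that by (simp add: scalar_prod_def)
    ultimately show ?thesis by simp
  qed
  then have "card {0..<n} \<le> card {0..<m}"
    by (intro card_le_of_left_inverse[where Y = "\<lambda>i k. A $$ (i, k)" and F = "\<lambda>k j. B $$ (k, j)"]) auto
  then show ?thesis by simp
qed

lemma mat_eq_if_mult_vec_eq:
  fixes A B :: "'k::semiring_1 mat"
  assumes A: "A \<in> carrier_mat n m" and B: "B \<in> carrier_mat n m"
    and eq: "\<And>v. v \<in> carrier_vec m \<Longrightarrow> A *\<^sub>v v = B *\<^sub>v v"
  shows "A = B"
proof (rule eq_matI)
  fix i j assume ij: "i < dim_row B" "j < dim_col B"
  have "(A *\<^sub>v unit_vec m j) $ i = (B *\<^sub>v unit_vec m j) $ i"
    using eq by simp
  then show "A $$ (i, j) = B $$ (i, j)"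
    using A B ij by simp
qed (use A B in auto)

lemma mult_mat_zero_vec [simp]:
  fixes A :: "'k::semiring_0 mat"
  assumes "A \<in> carrier_mat n m"
  shows "A *\<^sub>v 0\<^sub>v m = 0\<^sub>v n"
  using assms by (intro eq_vecI) (auto simp: scalar_prod_def)

lemma zero_mat_mult_vec [simp]:
  fixes v :: "'k::semiring_0 vec"
  assumes "v \<in> carrier_vec m"
  shows "0\<^sub>m n m *\<^sub>v v = 0\<^sub>v n"
  using assms by (intro eq_vecI) (auto simp: scalar_prod_def)

lemma sum_diag_mult_comm:
  fixes A B :: "'k::comm_semiring_0 mat"
  assumes "A \<in> carrier_mat n m" "B \<in> carrier_mat m n"
  shows "(\<Sum>i<n. (A * B) $$ (i, i)) = (\<Sum>i<m. (B * A) $$ (i, i))"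
proof -
  have "(\<Sum>i<n. (A * B) $$ (i, i)) = (\<Sum>i<n. \<Sum>k<m. A $$ (i, k) * B $$ (k, i))"
    using assms by (intro sum.cong) (auto simp: scalar_prod_def atLeast0LessThan)
  also have "\<dots> = (\<Sum>k<m. \<Sum>i<n. B $$ (k, i) * A $$ (i, k))"
    by (subst sum.swap) (simp add: mult.commute)
  also have "\<dots> = (\<Sum>i<m. (B * A) $$ (i, i))"
    using assms by (intro sum.cong) (auto simp: scalar_prod_def atLeast0LessThan)
  finally show ?thesis .
qed

section \<open>Subspaces and representations in matrix form\<close>

lemma subspace_module_vec_iff:
  fixes W :: "'k::field vec set"
  shows "VectorSpace.subspace class_ring W (module_vec TYPE('k) n) \<longleftrightarrow>
    W \<subseteq> carrier_vec n \<and> 0\<^sub>v n \<in> W \<and> (\<forall>v\<in>W. \<forall>w\<in>W. v + w \<in> W) \<and> (\<forall>c. \<forall>v\<in>W. c \<cdot>\<^sub>v v \<in> W)"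
proof -
  have "Module.module class_ring (module_vec TYPE('k) n)"
    using vec_vs by (auto simp: vectorspace_def)
  then show ?thesis
    using vec_vs[where 'a = 'k and n = n] unfolding VectorSpace.subspace_def submodule_def
    by (auto simp: module_vec_simps)
qed

lemma (in group) matrix_rep_iff:
  fixes \<rho> :: "'a \<Rightarrow> 'k::field mat"
  shows "matrix_rep G n \<rho> \<longleftrightarrow> (\<forall>g\<in>carrier G. \<rho> g \<in> carrier_mat n n) \<and> \<rho> \<one> = 1\<^sub>m n \<and>
    (\<forall>g\<in>carrier G. \<forall>h\<in>carrier G. \<rho> (g \<otimes> h) = \<rho> g * \<rho> h)" (is "?l \<longleftrightarrow> ?r")
proof
  let ?R = "ring_mat TYPE('k) n ()"
  interpret R: ring ?R by (rule ring_mat)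
  {
    assume ?l
    then have hom: "\<rho> \<in> hom G (units_of ?R)" by (simp add: matrix_rep_def)
    then interpret group_hom G "units_of ?R" \<rho>
      by (intro group_hom.intro group_hom_axioms.intro R.units_group is_group)
    have "\<rho> \<one> = 1\<^sub>m n"
      using hom_one by (simp add: units_of_one ring_mat_simps)
    moreover have "\<rho> g \<in> carrier_mat n n" if "g \<in> carrier G" for g
      using hom_closed[OF that] by (simp add: units_of_carrier Units_def ring_mat_simps)
    ultimately show ?r
      using hom_mult by (simp add: units_of_mult ring_mat_simps)
  }
  assume r: ?r
  have "\<rho> g \<in> Units ?R" if g: "g \<in> carrier G" for g
  proof -
    have "\<rho> g * \<rho> (inv g) = 1\<^sub>m n" "\<rho> (inv g) * \<rho> g = 1\<^sub>m n"
      using r g by (metis inv_closed r_inv, metis inv_closed l_inv)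
    then show ?thesis
      using r g unfolding Units_def ring_mat_simps by auto
  qed
  with r show ?l
    by (auto simp: matrix_rep_def hom_def units_of_carrier units_of_mult ring_mat_simps)
qed

text \<open>The columns of \<open>B\<close> are a basis of \<open>W\<close> and \<open>C\<close>
  reads off coordinates, so \<open>B * C\<close> is a projection onto \<open>W\<close>. Such a
  \<open>B\<close> has at most \<open>n\<close> columns, hence \<open>m\<close> can be taken
  maximal, and a vector of \<open>W\<close> that is missed would allow a further column.\<close>

lemma subspace_basis_matrix:
  fixes W :: "'k::field vec set"
  assumes W: "VectorSpace.subspace class_ring W (module_vec TYPE('k) n)"
  obtains m B C where "B \<in> carrier_mat n m" "C \<in> carrier_mat m n" "C * B = 1\<^sub>m m"
    "\<forall>v\<in>carrier_vec m. B *\<^sub>v v \<in> W" "\<forall>w\<in>W. B *\<^sub>v (C *\<^sub>v w) = w"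
proof -
  define P where "P m \<longleftrightarrow> (\<exists>B C. B \<in> carrier_mat n m \<and> C \<in> carrier_mat m n \<and> C * B = 1\<^sub>m m \<and>
    (\<forall>v\<in>carrier_vec m. B *\<^sub>v v \<in> W))" for m
  note W' = W[unfolded subspace_module_vec_iff]
  have bound: "m \<le> n" if "P m" for m
    using that mat_one_le_dim unfolding P_def by blast
  have "P 0"
  proof -
    have "0\<^sub>m n 0 *\<^sub>v v = 0\<^sub>v n" if "v \<in> carrier_vec 0" for v :: "'k vec"
      using that by (intro eq_vecI) (auto simp: scalar_prod_def)
    then show ?thesis unfolding P_def using W'
      by (intro exI[of _ "0\<^sub>m n 0"] exI[of _ "0\<^sub>m 0 n"]) auto
  qed
  define m where "m = (GREATEST m. P m)"
  have "P m"
    using GreatestI_nat[of P 0 n] \<open>P 0\<close> bound by (simp add: m_def)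
  then obtain B C where B: "B \<in> carrier_mat n m" and C: "C \<in> carrier_mat m n" and CB: "C * B = 1\<^sub>m m"
    and BW: "\<And>v. v \<in> carrier_vec m \<Longrightarrow> B *\<^sub>v v \<in> W" unfolding P_def by blast
  have max: "\<not> P (Suc m)"
    using Greatest_le_nat[of P "Suc m" n] bound by (auto simp: m_def)
  have "B *\<^sub>v (C *\<^sub>v w) = w" if w: "w \<in> W" for w
  proof (rule ccontr)
    assume neq: "B *\<^sub>v (C *\<^sub>v w) \<noteq> w"
    have wc: "w \<in> carrier_vec n" using w W' by auto
    \<comment> \<open>\<open>u\<close> is the part of \<open>w\<close> that \<open>B * C\<close>
      misses. It lies in \<open>W\<close> and in the kernel of \<open>C\<close>, and becomes the
      last column of \<open>B'\<close>.\<close>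
    define u where "u = w + (-1) \<cdot>\<^sub>v (B *\<^sub>v (C *\<^sub>v w))"
    have u: "u \<in> carrier_vec n" and uW: "u \<in> W"
      using wc w B C BW W' by (auto simp: u_def)
    have u_eq: "u $ i = w $ i - (B *\<^sub>v (C *\<^sub>v w)) $ i" if "i < n" for i
      using that wc B by (simp add: u_def)
    obtain k where k: "k < n" "u $ k \<noteq> 0"
    proof (rule ccontr)
      assume "\<not> thesis"
      then have "\<And>i. i < n \<Longrightarrow> u $ i = 0" using that by auto
      then have "B *\<^sub>v (C *\<^sub>v w) = w"
        using u_eq B wc by (intro eq_vecI) auto
      with neq show False by simp
    qed
    have Cu: "C *\<^sub>v u = 0\<^sub>v m"
    proof -
      have "C *\<^sub>v u = C *\<^sub>v w + (-1) \<cdot>\<^sub>v (C *\<^sub>v (B *\<^sub>v (C *\<^sub>v w)))"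
        using wc B C by (simp add: u_def mult_add_distrib_mat_vec[of _ m n] mult_mat_vec[of _ m n])
      also have "C *\<^sub>v (B *\<^sub>v (C *\<^sub>v w)) = (C * B) *\<^sub>v (C *\<^sub>v w)"
        using wc B C by simp
      finally show ?thesis using wc B C CB by (auto intro!: eq_vecI)
    qed
    \<comment> \<open>The new row of \<open>C'\<close> must vanish on the columns of
      \<open>B\<close> and be \<open>1\<close> on \<open>u\<close>. The rows of
      \<open>1 - B * C\<close> do the former, since \<open>B * C * B = B\<close>; as
      \<open>1 - B * C\<close> fixes \<open>u\<close> and entry \<open>k\<close> of \<open>u\<close>
      is nonzero, row \<open>k\<close> can be scaled to do the latter.\<close>
    define r where "r = (1 / u $ k) \<cdot>\<^sub>v row (1\<^sub>m n - B * C) k"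
    have r: "r \<in> carrier_vec n" using B C k by (auto simp: r_def intro!: carrier_vecI)
    have BCB: "B * C * B = B"
      using B C CB by (simp add: assoc_mult_mat[of _ n m _ n _ m])
    have rB: "r \<bullet> col B j = 0" if "j < m" for j
    proof -
      have "row (1\<^sub>m n - B * C) k \<bullet> col B j = ((1\<^sub>m n - B * C) * B) $$ (k, j)"
        using that k B C by simp
      also have "(1\<^sub>m n - B * C) * B = 1\<^sub>m n * B - B * C * B"
        using B C by (intro minus_mult_distrib_mat) auto
      also have "\<dots> = B - B" unfolding BCB using B by simp
      also have "\<dots> $$ (k, j) = 0"
        using that k B by simp
      finally show ?thesis using that k B C by (simp add: r_def)
    qed
    have ru: "r \<bullet> u = 1"
    proof -
      have "row (1\<^sub>m n - B * C) k \<bullet> u = ((1\<^sub>m n - B * C) *\<^sub>v u) $ k"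
        using k B C by simp
      also have "(1\<^sub>m n - B * C) *\<^sub>v u = 1\<^sub>m n *\<^sub>v u - B * C *\<^sub>v u"
        using B C u by (intro minus_mult_distrib_mat_vec) auto
      also have "B * C *\<^sub>v u = 0\<^sub>v n"
        using B C u Cu by (simp add: assoc_mult_mat_vec[of _ n m _ n])
      finally show ?thesis using k u B C by (simp add: r_def)
    qed
    define B' where "B' = mat n (Suc m) (\<lambda>(i, j). if j < m then B $$ (i, j) else u $ i)"
    define C' where "C' = mat (Suc m) n (\<lambda>(i, j). if i < m then C $$ (i, j) else r $ j)"
    have colB: "col B' j = (if j < m then col B j else u)" if "j < Suc m" for j
      using that B u by (intro eq_vecI) (auto simp: B'_def)
    have rowC: "row C' i = (if i < m then row C i else r)" if "i < Suc m" for i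
      using that C r by (intro eq_vecI) (auto simp: C'_def)
    have "C' * B' = 1\<^sub>m (Suc m)"
    proof (rule eq_matI)
      fix i j assume "i < dim_row (1\<^sub>m (Suc m))" "j < dim_col (1\<^sub>m (Suc m))"
      then have ij: "i < Suc m" "j < Suc m" by auto
      have cb: "row C i \<bullet> col B j = (if i = j then 1 else 0)" if "i < m" "j < m"
        using arg_cong[OF CB, of "\<lambda>M. M $$ (i, j)"] that B C by simp
      have cu: "row C i \<bullet> u = 0" if "i < m"
        using arg_cong[OF Cu, of "\<lambda>v. vec_index v i"] that C by simp
      have "(C' * B') $$ (i, j) = row C' i \<bullet> col B' j"
        using ij by (simp add: B'_def C'_def)
      also have "\<dots> = (if i = j then 1 else 0)"
        using ij cb cu rB ru by (auto simp: colB rowC)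
      finally show "(C' * B') $$ (i, j) = 1\<^sub>m (Suc m) $$ (i, j)" using ij by simp
    qed (auto simp: B'_def C'_def)
    moreover have "B' *\<^sub>v v \<in> W" if v: "v \<in> carrier_vec (Suc m)" for v
    proof -
      have "B' *\<^sub>v v = B *\<^sub>v vec m (\<lambda>i. v $ i) + v $ m \<cdot>\<^sub>v u"
        using v B u by (intro eq_vecI) (auto simp: B'_def scalar_prod_def mult.commute)
      moreover have "\<dots> \<in> W"
        using BW W' uW by simp
      ultimately show ?thesis by simp
    qed
    ultimately have "P (Suc m)"
      unfolding P_def by (intro exI[of _ B'] exI[of _ C']) (auto simp: B'_def C'_def)
    with max show False by simp
  qed
  with that B C CB BW show thesis by blast
qed

section \<open>Schur's lemma and invariant subspaces\<close>

lemma (in group) irreducible_repD: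
  fixes \<rho> :: "'a \<Rightarrow> 'k::field mat"
  assumes "irreducible_rep G n \<rho>"
  shows "n > 0" "\<And>g. g \<in> carrier G \<Longrightarrow> \<rho> g \<in> carrier_mat n n" "\<rho> \<one> = 1\<^sub>m n"
    "\<And>g h. g \<in> carrier G \<Longrightarrow> h \<in> carrier G \<Longrightarrow> \<rho> (g \<otimes> h) = \<rho> g * \<rho> h"
    "\<And>W. VectorSpace.subspace class_ring W (module_vec TYPE('k) n) \<Longrightarrow>
      (\<And>g w. g \<in> carrier G \<Longrightarrow> w \<in> W \<Longrightarrow> \<rho> g *\<^sub>v w \<in> W) \<Longrightarrow> W = {0\<^sub>v n} \<or> W = carrier_vec n"
  using assms unfolding irreducible_rep_def matrix_rep_iff by blast+

lemma subspace_kernel: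
  fixes T :: "'k::field mat"
  assumes T: "T \<in> carrier_mat n m"
  shows "VectorSpace.subspace class_ring {v \<in> carrier_vec m. T *\<^sub>v v = 0\<^sub>v n} (module_vec TYPE('k) m)"
  using T by (auto simp: subspace_module_vec_iff mult_add_distrib_mat_vec[of _ n m] mult_mat_vec[of _ n m])

lemma subspace_range:
  fixes T :: "'k::field mat"
  assumes T: "T \<in> carrier_mat n m"
  shows "VectorSpace.subspace class_ring ((*\<^sub>v) T ` carrier_vec m) (module_vec TYPE('k) n)"
  unfolding subspace_module_vec_iff
proof (intro conjI ballI allI)
  show "0\<^sub>v n \<in> (*\<^sub>v) T ` carrier_vec m"
    using T by (intro image_eqI[of _ _ "0\<^sub>v m"]) auto
next
  fix v w assume "v \<in> (*\<^sub>v) T ` carrier_vec m" "w \<in> (*\<^sub>v) T ` carrier_vec m"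
  then obtain x y where "x \<in> carrier_vec m" "y \<in> carrier_vec m" "v = T *\<^sub>v x" "w = T *\<^sub>v y" by auto
  then show "v + w \<in> (*\<^sub>v) T ` carrier_vec m"
    using T by (intro image_eqI[of _ _ "x + y"]) (auto simp: mult_add_distrib_mat_vec[of _ n m])
next
  fix c v assume "v \<in> (*\<^sub>v) T ` carrier_vec m"
  then obtain x where "x \<in> carrier_vec m" "v = T *\<^sub>v x" by auto
  then show "c \<cdot>\<^sub>v v \<in> (*\<^sub>v) T ` carrier_vec m"
    using T by (intro image_eqI[of _ _ "c \<cdot>\<^sub>v x"]) (auto simp: mult_mat_vec[of _ n m])
qed (use T in auto)

text \<open>The kernel of \<open>T\<close> is invariant under \<open>\<tau>\<close>, so a single
  nonzero vector in it makes it everything. This form serves both Schur's lemma and, over the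
  algebraic closure, the subtraction of an eigenvalue.\<close>

lemma (in group) intertwiner_kernel:
  fixes \<sigma> \<tau> :: "'a \<Rightarrow> 'k::field mat"
  assumes \<sigma>: "matrix_rep G n \<sigma>" and \<tau>: "irreducible_rep G m \<tau>"
    and T: "T \<in> carrier_mat n m" and comm: "\<And>g. g \<in> carrier G \<Longrightarrow> \<sigma> g * T = T * \<tau> g"
    and v: "v \<in> carrier_vec m" "v \<noteq> 0\<^sub>v m" "T *\<^sub>v v = 0\<^sub>v n"
  shows "T = 0\<^sub>m n m"
proof -
  note \<tau>' = irreducible_repD[OF \<tau>]
  let ?K = "{v \<in> carrier_vec m. T *\<^sub>v v = 0\<^sub>v n}"
  have "\<tau> g *\<^sub>v w \<in> ?K" if g: "g \<in> carrier G" and w: "w \<in> ?K" for g w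
  proof -
    have "\<sigma> g \<in> carrier_mat n n" using \<sigma> g by (simp add: matrix_rep_iff)
    have "T *\<^sub>v (\<tau> g *\<^sub>v w) = T * \<tau> g *\<^sub>v w"
      using T \<tau>'(2)[OF g] w by simp
    also have "\<dots> = \<sigma> g *\<^sub>v (T *\<^sub>v w)"
      using T \<open>\<sigma> g \<in> _\<close> w by (simp flip: comm[OF g])
    finally have "T *\<^sub>v (\<tau> g *\<^sub>v w) = \<sigma> g *\<^sub>v (T *\<^sub>v w)" .
    then show ?thesis
      using w \<open>\<sigma> g \<in> _\<close> \<tau>'(2)[OF g] by auto
  qed
  from \<tau>'(5)[OF subspace_kernel[OF T] this] v have "?K = carrier_vec m" by blast
  then have "T *\<^sub>v w = 0\<^sub>m n m *\<^sub>v w" if "w \<in> carrier_vec m" for w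
    using that by (auto simp: set_eq_iff)
  then show ?thesis
    using T by (intro mat_eq_if_mult_vec_eq) auto
qed

text \<open>Kernel and range of an intertwiner are invariant, so a nonzero \<open>T\<close> is
  injective and onto. Its inverse is built as a matrix because \<open>isomorphic_rep\<close> asks
  for explicit witnesses.\<close>

lemma (in group) schur_iso:
  fixes \<sigma> \<tau> :: "'a \<Rightarrow> 'k::field mat"
  assumes \<sigma>: "irreducible_rep G n \<sigma>" and \<tau>: "irreducible_rep G m \<tau>"
    and T: "T \<in> carrier_mat n m" and comm: "\<And>g. g \<in> carrier G \<Longrightarrow> \<sigma> g * T = T * \<tau> g"
    and nz: "T \<noteq> 0\<^sub>m n m"
  shows "isomorphic_rep G \<sigma> \<tau>"
proof -
  note \<sigma>' = irreducible_repD[OF \<sigma>]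
  note \<tau>' = irreducible_repD[OF \<tau>]
  have \<sigma>_rep: "matrix_rep G n \<sigma>" using \<sigma> by (simp add: irreducible_rep_def)
  let ?R = "(*\<^sub>v) T ` carrier_vec m"
  have "\<sigma> g *\<^sub>v w \<in> ?R" if g: "g \<in> carrier G" and w: "w \<in> ?R" for g w
  proof -
    from w obtain x where x: "x \<in> carrier_vec m" "w = T *\<^sub>v x" by auto
    have "\<sigma> g *\<^sub>v w = \<sigma> g * T *\<^sub>v x"
      using T \<sigma>'(2)[OF g] x by simp
    also have "\<dots> = T *\<^sub>v (\<tau> g *\<^sub>v x)"
      using T \<tau>'(2)[OF g] x by (simp add: comm[OF g])
    finally have "\<sigma> g *\<^sub>v w = T *\<^sub>v (\<tau> g *\<^sub>v x)" .
    then show ?thesis using x \<tau>'(2)[OF g] by auto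
  qed
  from \<sigma>'(5)[OF subspace_range[OF T] this] have "?R = {0\<^sub>v n} \<or> ?R = carrier_vec n" by blast
  moreover have "?R \<noteq> {0\<^sub>v n}"
  proof
    assume R: "?R = {0\<^sub>v n}"
    have "T *\<^sub>v w = 0\<^sub>m n m *\<^sub>v w" if "w \<in> carrier_vec m" for w
      using that R by auto
    then have "T = 0\<^sub>m n m"
      using T by (intro mat_eq_if_mult_vec_eq) auto
    with nz show False by simp
  qed
  ultimately have R: "?R = carrier_vec n" by blast
  have "\<exists>x. x \<in> carrier_vec m \<and> T *\<^sub>v x = unit_vec n i" for i
  proof -
    have "unit_vec n i \<in> ?R" unfolding R by simp
    then show ?thesis by (auto simp: eq_commute)
  qed
  then obtain x where x: "x i \<in> carrier_vec m" "T *\<^sub>v x i = unit_vec n i" for i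
    by metis
  \<comment> \<open>Column \<open>j\<close> of \<open>S\<close> is a preimage of the
    \<open>j\<close>-th unit vector, so \<open>S\<close> is a right inverse of
    \<open>T\<close>.\<close>
  define S where "S = mat m n (\<lambda>(i, j). x j $ i)"
  have S: "S \<in> carrier_mat m n" by (simp add: S_def)
  have col: "col S j = x j" if "j < n" for j
    using x(1)[of j] that by (intro eq_vecI) (auto simp: S_def)
  have TS: "T * S = 1\<^sub>m n"
  proof (rule eq_matI)
    fix i j assume "i < dim_row (1\<^sub>m n :: 'k mat)" "j < dim_col (1\<^sub>m n :: 'k mat)"
    then have ij: "i < n" "j < n" by auto
    have "(T * S) $$ (i, j) = (T *\<^sub>v x j) $ i"
      using ij T S by (simp add: col)
    then show "(T * S) $$ (i, j) = 1\<^sub>m n $$ (i, j)"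
      using ij by (simp add: x)
  qed (use T S in auto)
  \<comment> \<open>Since \<open>T * S = 1\<close>, the difference of
    \<open>S * T *\<^sub>v v\<close> and \<open>v\<close> lies in the kernel of \<open>T\<close>; if
    it were nonzero, \<open>T\<close> would be zero.\<close>
  have "S * T *\<^sub>v v = 1\<^sub>m m *\<^sub>v v" if v: "v \<in> carrier_vec m" for v
  proof (rule ccontr)
    assume neq: "S * T *\<^sub>v v \<noteq> 1\<^sub>m m *\<^sub>v v"
    define u where "u = S * T *\<^sub>v v - v"
    have u: "u \<in> carrier_vec m" using v S T by (auto simp: u_def)
    have "u \<noteq> 0\<^sub>v m"
    proof
      assume u0: "u = 0\<^sub>v m"
      have "S * T *\<^sub>v v = v"
      proof (rule eq_vecI)
        fix i assume i: "i < dim_vec v"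
        then have "u $ i = 0" using v by (simp add: u0)
        then show "(S * T *\<^sub>v v) $ i = v $ i"
          using v S T i by (simp add: u_def)
      qed (use v S T in auto)
      with neq v show False by simp
    qed
    moreover have "T *\<^sub>v u = 0\<^sub>v n"
    proof -
      have "T *\<^sub>v u = T *\<^sub>v (S *\<^sub>v (T *\<^sub>v v)) - T *\<^sub>v v"
        using T S v by (simp add: u_def mult_minus_distrib_mat_vec[of _ n m])
      also have "T *\<^sub>v (S *\<^sub>v (T *\<^sub>v v)) = T * S *\<^sub>v (T *\<^sub>v v)"
        using T S v by simp
      finally show ?thesis using T v by (simp add: TS)
    qed
    ultimately show False
      using intertwiner_kernel[OF \<sigma>_rep \<tau> T comm u] nz by blast
  qed
  then have ST: "S * T = 1\<^sub>m m"
    using S T by (intro mat_eq_if_mult_vec_eq) auto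
  have nm: "n = m"
    using mat_one_le_dim[OF T S TS] mat_one_le_dim[OF S T ST] by simp
  have "similar_mat_wit (\<sigma> g) (\<tau> g) T S" if g: "g \<in> carrier G" for g
  proof (rule similar_mat_witI)
    have "T * \<tau> g * S = \<sigma> g * T * S" using comm[OF g] by simp
    also have "\<dots> = \<sigma> g"
      using T S TS \<sigma>'(2)[OF g] by (simp add: assoc_mult_mat[of _ n n _ m _ n])
    finally show "\<sigma> g = T * \<tau> g * S" by simp
  qed (use T S TS ST nm g \<sigma>'(2) \<tau>'(2) in auto)
  then show ?thesis unfolding isomorphic_rep_def by blast
qed

text \<open>A proper nonzero invariant subspace \<open>W\<close> makes \<open>\<rho>\<close> block
  triangular; the diagonal blocks are the actions on \<open>W\<close> and on the quotient by
  \<open>W\<close>. Both are smaller than \<open>n\<close>, which drives the later induction on the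
  degree.\<close>

lemma (in group) reducible_rep_split:
  fixes \<rho> :: "'a \<Rightarrow> 'k::field mat"
  assumes \<rho>: "matrix_rep G n \<rho>" and n: "n > 0" and red: "\<not> irreducible_rep G n \<rho>"
  obtains m k and \<sigma> \<tau> :: "'a \<Rightarrow> 'k mat" where "m < n" "k < n" "matrix_rep G m \<sigma>" "matrix_rep G k \<tau>"
    "\<forall>g\<in>carrier G. (\<Sum>i<n. \<rho> g $$ (i, i)) = (\<Sum>i<m. \<sigma> g $$ (i, i)) + (\<Sum>i<k. \<tau> g $$ (i, i))"
proof -
  have rc: "\<rho> g \<in> carrier_mat n n" if "g \<in> carrier G" for g
    using \<rho> that by (simp add: matrix_rep_iff)
  have r1: "\<rho> \<one> = 1\<^sub>m n" and rmult: "\<rho> (g \<otimes> h) = \<rho> g * \<rho> h" if "g \<in> carrier G" "h \<in> carrier G" for g h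
    using \<rho> that by (simp_all add: matrix_rep_iff)
  from red \<rho> n obtain W where W: "VectorSpace.subspace class_ring W (module_vec TYPE('k) n)"
    and inv: "\<And>g w. g \<in> carrier G \<Longrightarrow> w \<in> W \<Longrightarrow> \<rho> g *\<^sub>v w \<in> W"
    and proper: "W \<noteq> {0\<^sub>v n}" "W \<noteq> carrier_vec n"
    unfolding irreducible_rep_def by metis
  note W' = W[unfolded subspace_module_vec_iff]
  obtain m B C where B: "B \<in> carrier_mat n m" and C: "C \<in> carrier_mat m n" and CB: "C * B = 1\<^sub>m m"
    and BW: "\<And>v. v \<in> carrier_vec m \<Longrightarrow> B *\<^sub>v v \<in> W" and BC: "\<And>w. w \<in> W \<Longrightarrow> B *\<^sub>v (C *\<^sub>v w) = w"
    by (rule subspace_basis_matrix[OF W]) blast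
  \<comment> \<open>The kernel of \<open>C\<close> is a complement of \<open>W\<close>, in general
    not an invariant one; it stands for the quotient by \<open>W\<close>.\<close>
  let ?U = "{v \<in> carrier_vec n. C *\<^sub>v v = 0\<^sub>v m}"
  obtain k D F where D: "D \<in> carrier_mat n k" and F: "F \<in> carrier_mat k n" and FD: "F * D = 1\<^sub>m k"
    and DU: "\<And>v. v \<in> carrier_vec k \<Longrightarrow> D *\<^sub>v v \<in> ?U" and DF: "\<And>w. w \<in> ?U \<Longrightarrow> D *\<^sub>v (F *\<^sub>v w) = w"
    by (rule subspace_basis_matrix[OF subspace_kernel[OF C]]) blast
  have CB': "C *\<^sub>v (B *\<^sub>v v) = v" if "v \<in> carrier_vec m" for v
    using B C CB that by (metis assoc_mult_mat_vec one_mult_mat_vec)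
  have FD': "F *\<^sub>v (D *\<^sub>v v) = v" if "v \<in> carrier_vec k" for v
    using D F FD that by (metis assoc_mult_mat_vec one_mult_mat_vec)
  \<comment> \<open>Projecting by \<open>1 - B * C\<close> before taking coordinates in
    \<open>?U\<close> makes \<open>E\<close> vanish on \<open>W\<close>, so \<open>E\<close> is the
    coordinate map of the quotient, and the projections \<open>B * C\<close> and
    \<open>D * E\<close> add up to the identity.\<close>
  define E where "E = F * (1\<^sub>m n - B * C)"
  have E: "E \<in> carrier_mat k n" using F B C by (auto simp: E_def)
  have Ev: "E *\<^sub>v v = F *\<^sub>v (v - B *\<^sub>v (C *\<^sub>v v))" if "v \<in> carrier_vec n" for v
  proof -
    have "1\<^sub>m n - B * C \<in> carrier_mat n n" using B C by auto
    then have "E *\<^sub>v v = F *\<^sub>v ((1\<^sub>m n - B * C) *\<^sub>v v)"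
      using that F by (simp add: E_def)
    also have "(1\<^sub>m n - B * C) *\<^sub>v v = 1\<^sub>m n *\<^sub>v v - B * C *\<^sub>v v"
      using that B C by (intro minus_mult_distrib_mat_vec) auto
    finally show ?thesis using that B C by simp
  qed
  have U: "v - B *\<^sub>v (C *\<^sub>v v) \<in> ?U" if "v \<in> carrier_vec n" for v
    using that B C by (simp add: mult_minus_distrib_mat_vec[of _ m n] CB')
  have DE: "D *\<^sub>v (E *\<^sub>v v) = v - B *\<^sub>v (C *\<^sub>v v)" if "v \<in> carrier_vec n" for v
    using that U DF by (simp add: Ev)
  have EW: "E *\<^sub>v w = 0\<^sub>v k" if "w \<in> W" for w
  proof -
    have "w \<in> carrier_vec n" using that W' by auto
    then show ?thesis using that F by (simp add: Ev BC)
  qed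
  have ED: "E *\<^sub>v (D *\<^sub>v v) = v" if "v \<in> carrier_vec k" for v
  proof -
    have "D *\<^sub>v v \<in> carrier_vec n" "C *\<^sub>v (D *\<^sub>v v) = 0\<^sub>v m" using DU[OF that] by auto
    then show ?thesis using that B by (simp add: Ev FD')
  qed
  text \<open>\<open>B\<close> and \<open>D\<close> embed \<open>W\<close> and a complement of it, with left inverses \<open>C\<close> and \<open>E\<close>.\<close>
  have "m < n"
  proof (rule ccontr)
    assume "\<not> m < n"
    with mat_one_le_dim[OF C B CB] have "m = n" by simp
    then have "B * C = 1\<^sub>m n"
      using mat_mult_left_right_inverse[OF _ _ CB] B C by simp
    then have "B *\<^sub>v (C *\<^sub>v v) = v" if "v \<in> carrier_vec n" for v
      using that B C by (metis assoc_mult_mat_vec one_mult_mat_vec)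
    then have "carrier_vec n \<subseteq> W"
      using BW C by (metis mult_mat_vec_carrier subsetI)
    with W' proper show False by blast
  qed
  have "E * D = 1\<^sub>m k"
    using E D by (intro mat_eq_if_mult_vec_eq[of _ k k]) (auto simp: ED)
  have "k < n"
  proof (rule ccontr)
    assume "\<not> k < n"
    with mat_one_le_dim[OF E D \<open>E * D = _\<close>] have "k = n" by simp
    then have "D * E = 1\<^sub>m n"
      using mat_mult_left_right_inverse[OF _ _ \<open>E * D = _\<close>] D E by simp
    have "w = 0\<^sub>v n" if "w \<in> W" for w
    proof -
      have w: "w \<in> carrier_vec n" using that W' by auto
      then have "w = D *\<^sub>v (E *\<^sub>v w)"
        using \<open>D * E = _\<close> D E by (metis assoc_mult_mat_vec one_mult_mat_vec)
      then show ?thesis using EW[OF that] D by auto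
    qed
    with W' proper show False by blast
  qed
  define \<sigma> where "\<sigma> g = C * (\<rho> g * B)" for g
  define \<tau> where "\<tau> g = E * (\<rho> g * D)" for g
  have \<sigma>c: "\<sigma> g \<in> carrier_mat m m" and \<tau>c: "\<tau> g \<in> carrier_mat k k" if "g \<in> carrier G" for g
    using rc[OF that] B C D E by (auto simp: \<sigma>_def \<tau>_def)
  have \<sigma>v: "\<sigma> g *\<^sub>v v = C *\<^sub>v (\<rho> g *\<^sub>v (B *\<^sub>v v))" if "g \<in> carrier G" "v \<in> carrier_vec m" for g v
    using rc[OF that(1)] that(2) B C by (simp add: \<sigma>_def assoc_mult_mat_vec[of _ m n _ m])
  have \<tau>v: "\<tau> g *\<^sub>v v = E *\<^sub>v (\<rho> g *\<^sub>v (D *\<^sub>v v))" if "g \<in> carrier G" "v \<in> carrier_vec k" for g v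
    using rc[OF that(1)] that(2) D E by (simp add: \<tau>_def assoc_mult_mat_vec[of _ k n _ k])
  have Bc: "B *\<^sub>v v \<in> carrier_vec n" if "v \<in> carrier_vec m" for v
    using B that by simp
  have Dc: "D *\<^sub>v v \<in> carrier_vec n" if "v \<in> carrier_vec k" for v
    using D that by simp
  have "matrix_rep G m \<sigma>"
    unfolding matrix_rep_iff
  proof (intro conjI ballI)
    show "\<sigma> \<one> = 1\<^sub>m m"
      using r1[OF one_closed one_closed] B C CB by (simp add: \<sigma>_def)
    fix g h assume gh: "g \<in> carrier G" "h \<in> carrier G"
    show "\<sigma> (g \<otimes> h) = \<sigma> g * \<sigma> h"
    proof (rule mat_eq_if_mult_vec_eq)
      fix v :: "'k vec" assume v: "v \<in> carrier_vec m"
      have w: "\<rho> h *\<^sub>v (B *\<^sub>v v) \<in> W" using inv BW gh v by simp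
      have "\<sigma> g * \<sigma> h *\<^sub>v v = \<sigma> g *\<^sub>v (\<sigma> h *\<^sub>v v)"
        using gh v \<sigma>c by (intro assoc_mult_mat_vec) auto
      also have "\<dots> = C *\<^sub>v (\<rho> g *\<^sub>v (B *\<^sub>v (C *\<^sub>v (\<rho> h *\<^sub>v (B *\<^sub>v v)))))"
        using \<sigma>v gh v \<sigma>c[OF gh(2)] by (metis mult_mat_vec_carrier)
      also have "\<dots> = C *\<^sub>v (\<rho> g *\<^sub>v (\<rho> h *\<^sub>v (B *\<^sub>v v)))"
        using BC[OF w] by simp
      also have "\<dots> = \<sigma> (g \<otimes> h) *\<^sub>v v"
        using gh v Bc[OF v] rc by (simp add: \<sigma>v rmult assoc_mult_mat_vec[of _ n n _ n])
      finally show "\<sigma> (g \<otimes> h) *\<^sub>v v = \<sigma> g * \<sigma> h *\<^sub>v v" by simp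
    qed (use \<sigma>c[of "g \<otimes> h"] \<sigma>c[OF gh(1)] \<sigma>c[OF gh(2)] gh in auto)
  qed (use \<sigma>c in auto)
  moreover have "matrix_rep G k \<tau>"
    unfolding matrix_rep_iff
  proof (intro conjI ballI)
    show "\<tau> \<one> = 1\<^sub>m k"
      using r1[OF one_closed one_closed] D E \<open>E * D = _\<close> by (simp add: \<tau>_def)
    fix g h assume gh: "g \<in> carrier G" "h \<in> carrier G"
    show "\<tau> (g \<otimes> h) = \<tau> g * \<tau> h"
    proof (rule mat_eq_if_mult_vec_eq)
      fix v :: "'k vec" assume v: "v \<in> carrier_vec k"
      define w where "w = \<rho> h *\<^sub>v (D *\<^sub>v v)"
      have w: "w \<in> carrier_vec n" using rc[OF gh(2)] Dc[OF v] by (simp add: w_def)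
      \<comment> \<open>\<open>y\<close> is the error made in \<open>\<rho> g *\<^sub>v w\<close> by
        replacing \<open>w\<close> with its component in \<open>?U\<close>. It lies in
        \<open>W\<close> by invariance, so \<open>E\<close> kills it, and this makes
        \<open>\<tau>\<close> multiplicative.\<close>
      define y where "y = \<rho> g *\<^sub>v (B *\<^sub>v (C *\<^sub>v w))"
      have y: "y \<in> W" using inv BW gh w C by (simp add: y_def)
      then have yc: "y \<in> carrier_vec n" using W' by auto
      have "\<tau> g * \<tau> h *\<^sub>v v = \<tau> g *\<^sub>v (\<tau> h *\<^sub>v v)"
        using gh v \<tau>c by (intro assoc_mult_mat_vec) auto
      also have "\<dots> = E *\<^sub>v (\<rho> g *\<^sub>v (D *\<^sub>v (E *\<^sub>v w)))"
        using \<tau>v gh v \<tau>c[OF gh(2)] unfolding w_def by (metis mult_mat_vec_carrier)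
      also have "\<dots> = E *\<^sub>v (\<rho> g *\<^sub>v w - y)"
        using w B C rc[OF gh(1)] by (simp add: DE y_def mult_minus_distrib_mat_vec[of _ n n])
      also have "\<dots> = E *\<^sub>v (\<rho> g *\<^sub>v w) - E *\<^sub>v y"
        using w yc rc[OF gh(1)] E by (intro mult_minus_distrib_mat_vec) auto
      also have "\<dots> = E *\<^sub>v (\<rho> g *\<^sub>v w)"
        using w rc[OF gh(1)] E EW[OF y] by simp
      also have "\<dots> = \<tau> (g \<otimes> h) *\<^sub>v v"
        using gh v Dc[OF v] rc by (simp add: w_def \<tau>v rmult assoc_mult_mat_vec[of _ n n _ n])
      finally show "\<tau> (g \<otimes> h) *\<^sub>v v = \<tau> g * \<tau> h *\<^sub>v v" by simp
    qed (use \<tau>c[of "g \<otimes> h"] \<tau>c[OF gh(1)] \<tau>c[OF gh(2)] gh in auto)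
  qed (use \<tau>c in auto)
  moreover have "(\<Sum>i<n. \<rho> g $$ (i, i)) = (\<Sum>i<m. \<sigma> g $$ (i, i)) + (\<Sum>i<k. \<tau> g $$ (i, i))"
    if g: "g \<in> carrier G" for g
  proof -
    \<comment> \<open>The identity \<open>B * C + D * E\<close> is inserted after
      \<open>\<rho> g\<close>; cyclicity of the trace then turns the two summands into the traces of
      \<open>\<sigma> g\<close> and \<open>\<tau> g\<close>.\<close>
    have "\<rho> g = \<rho> g * B * C + \<rho> g * D * E"
    proof (rule mat_eq_if_mult_vec_eq)
      fix v :: "'k vec" assume v: "v \<in> carrier_vec n"
      have cv: "C *\<^sub>v v \<in> carrier_vec m" "E *\<^sub>v v \<in> carrier_vec k" using C E v by auto
      have "v = B *\<^sub>v (C *\<^sub>v v) + D *\<^sub>v (E *\<^sub>v v)"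
        using v B Bc[OF cv(1)] unfolding DE[OF v] by (intro eq_vecI) auto
      then have "\<rho> g *\<^sub>v v = \<rho> g *\<^sub>v (B *\<^sub>v (C *\<^sub>v v) + D *\<^sub>v (E *\<^sub>v v))" by simp
      also have "\<dots> = \<rho> g *\<^sub>v (B *\<^sub>v (C *\<^sub>v v)) + \<rho> g *\<^sub>v (D *\<^sub>v (E *\<^sub>v v))"
        using rc[OF g] Bc Dc cv by (intro mult_add_distrib_mat_vec) auto
      also have "\<dots> = (\<rho> g * B * C + \<rho> g * D * E) *\<^sub>v v"
      proof -
        have "(\<rho> g * B * C + \<rho> g * D * E) *\<^sub>v v = \<rho> g * B * C *\<^sub>v v + \<rho> g * D * E *\<^sub>v v"
          using rc[OF g] B C D E v by (intro add_mult_distrib_mat_vec[of _ n n]) auto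
        moreover have "\<rho> g * B * C *\<^sub>v v = \<rho> g *\<^sub>v (B *\<^sub>v (C *\<^sub>v v))"
          using rc[OF g] B C v cv by (simp add: assoc_mult_mat_vec[of _ n m _ n] del: assoc_mult_mat)
        moreover have "\<rho> g * D * E *\<^sub>v v = \<rho> g *\<^sub>v (D *\<^sub>v (E *\<^sub>v v))"
          using rc[OF g] D E v cv by (simp add: assoc_mult_mat_vec[of _ n k _ n] del: assoc_mult_mat)
        ultimately show ?thesis by simp
      qed
      finally show "\<rho> g *\<^sub>v v = (\<rho> g * B * C + \<rho> g * D * E) *\<^sub>v v" .
    qed (use rc[OF g] B C D E in auto)
    then have "(\<Sum>i<n. \<rho> g $$ (i, i)) = (\<Sum>i<n. (\<rho> g * B * C + \<rho> g * D * E) $$ (i, i))" by simp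
    also have "\<dots> = (\<Sum>i<n. (\<rho> g * B * C) $$ (i, i)) + (\<Sum>i<n. (\<rho> g * D * E) $$ (i, i))"
      using rc[OF g] B C D E by (simp add: sum.distrib del: index_mult_mat(1))
    also have "(\<Sum>i<n. (\<rho> g * B * C) $$ (i, i)) = (\<Sum>i<m. \<sigma> g $$ (i, i))"
      unfolding \<sigma>_def using rc[OF g] B C by (intro sum_diag_mult_comm) auto
    also have "(\<Sum>i<n. (\<rho> g * D * E) $$ (i, i)) = (\<Sum>i<k. \<tau> g $$ (i, i))"
      unfolding \<tau>_def using rc[OF g] D E by (intro sum_diag_mult_comm) auto
    finally show ?thesis .
  qed
  ultimately show thesis
    using that \<open>m < n\<close> \<open>k < n\<close> by blast
qed

section \<open>Matrix coefficients\<close>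

text \<open>Strong induction on the degree: traces are additive along
  \<open>reducible_rep_split\<close>, which leads down to irreducible representations, where each
  diagonal entry is annihilated.\<close>

lemma (in group) trace_combination_zero:
  fixes f :: "'a \<Rightarrow> 'k::field" and \<rho> :: "'a \<Rightarrow> 'k mat"
  assumes ann: "\<And>d (\<sigma> :: 'a \<Rightarrow> 'k mat) p q. irreducible_rep G d \<sigma> \<Longrightarrow> p < d \<Longrightarrow> q < d \<Longrightarrow>
      (\<Sum>g\<in>carrier G. f g * \<sigma> g $$ (p, q)) = 0"
    and \<rho>: "matrix_rep G n \<rho>"
  shows "(\<Sum>g\<in>carrier G. f g * (\<Sum>i<n. \<rho> g $$ (i, i))) = 0"
  using \<rho>
proof (induction n arbitrary: \<rho> rule: less_induct)
  case (less n)
  show ?case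
  \<comment> \<open>Degree \<open>0\<close> is listed separately because irreducibility includes
    positive degree; its trace is an empty sum.\<close>
  proof (cases "n = 0 \<or> irreducible_rep G n \<rho>")
    case True
    have "(\<Sum>g\<in>carrier G. f g * (\<Sum>i<n. \<rho> g $$ (i, i))) = (\<Sum>i<n. \<Sum>g\<in>carrier G. f g * \<rho> g $$ (i, i))"
      unfolding sum_distrib_left by (rule sum.swap)
    also have "\<dots> = 0"
      using True ann by (intro sum.neutral) auto
    finally show ?thesis .
  next
    case False
    then have "n > 0" "\<not> irreducible_rep G n \<rho>" by auto
    with less.prems obtain m k \<sigma> \<tau> where
      *: "m < n" "k < n" "matrix_rep G m \<sigma>" "matrix_rep G k \<tau>"
      and tr: "\<forall>g\<in>carrier G.
        (\<Sum>i<n. \<rho> g $$ (i, i)) = (\<Sum>i<m. \<sigma> g $$ (i, i)) + (\<Sum>i<k. \<tau> g $$ (i, i))"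
      by (rule reducible_rep_split) blast
    have "(\<Sum>g\<in>carrier G. f g * (\<Sum>i<n. \<rho> g $$ (i, i))) =
      (\<Sum>g\<in>carrier G. f g * (\<Sum>i<m. \<sigma> g $$ (i, i)) + f g * (\<Sum>i<k. \<tau> g $$ (i, i)))"
      using tr by (intro sum.cong) (auto simp: distrib_left)
    also have "\<dots> = 0"
      using less.IH[OF *(1,3)] less.IH[OF *(2,4)] by (simp add: sum.distrib)
    finally show ?thesis .
  qed
qed

text \<open>The group acts on itself by left translation, written as permutation matrices along an
  enumeration \<open>e\<close>. Translation by a nonidentity element fixes no point, whence the
  trace.\<close>

lemma (in group) regular_rep_exists:
  assumes fin: "finite (carrier G)"
  obtains \<rho> :: "'a \<Rightarrow> 'k::field mat" where "matrix_rep G (card (carrier G)) \<rho>"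
    "\<forall>g\<in>carrier G.
      (\<Sum>i<card (carrier G). \<rho> g $$ (i, i)) = (if g = \<one> then of_nat (card (carrier G)) else 0)"
proof -
  define a where "a = card (carrier G)"
  obtain e where e: "bij_betw e {..<a} (carrier G)"
    using ex_bij_betw_nat_finite[OF fin] unfolding a_def atLeast0LessThan by blast
  have ec: "e x \<in> carrier G" if "x < a" for x
    using e that by (auto simp: bij_betw_def)
  have e_inj: "e x = e y \<longleftrightarrow> x = y" if "x < a" "y < a" for x y
    using e that by (auto simp: bij_betw_def inj_on_def)
  define \<rho> :: "'a \<Rightarrow> 'k mat" where
    "\<rho> g = mat a a (\<lambda>(x, y). if e x = g \<otimes> e y then 1 else 0)" for g
  have "matrix_rep G a \<rho>"
    unfolding matrix_rep_iff
  proof (intro conjI ballI)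
    show "\<rho> \<one> = 1\<^sub>m a"
      by (intro eq_matI) (auto simp: \<rho>_def ec e_inj)
    fix g h assume gh: "g \<in> carrier G" "h \<in> carrier G"
    show "\<rho> (g \<otimes> h) = \<rho> g * \<rho> h"
    proof (rule eq_matI)
      fix x y assume "x < dim_row (\<rho> g * \<rho> h)" "y < dim_col (\<rho> g * \<rho> h)"
      then have xy: "x < a" "y < a" by (auto simp: \<rho>_def)
      have "h \<otimes> e y \<in> e ` {..<a}"
        using e gh ec[OF xy(2)] by (simp add: bij_betw_def)
      then obtain z0 where "h \<otimes> e y = e z0" "z0 \<in> {..<a}" by (rule imageE)
      then have z0: "z0 < a" "e z0 = h \<otimes> e y" by simp_all
      have "(\<rho> g * \<rho> h) $$ (x, y) = (\<Sum>z<a. \<rho> g $$ (x, z) * \<rho> h $$ (z, y))"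
        using xy by (simp add: \<rho>_def scalar_prod_def atLeast0LessThan)
      also have "\<dots> = (\<Sum>z<a. if z = z0 then \<rho> g $$ (x, z) else 0)"
        using xy z0 by (intro sum.cong) (auto simp: \<rho>_def e_inj simp flip: z0(2))
      also have "\<dots> = \<rho> g $$ (x, z0)"
        using z0 by simp
      also have "\<dots> = \<rho> (g \<otimes> h) $$ (x, y)"
        using xy z0 gh ec by (simp add: \<rho>_def m_assoc)
      finally show "\<rho> (g \<otimes> h) $$ (x, y) = (\<rho> g * \<rho> h) $$ (x, y)" by simp
    qed (auto simp: \<rho>_def)
  qed (auto simp: \<rho>_def)
  moreover have "(\<Sum>i<a. \<rho> g $$ (i, i)) = (if g = \<one> then of_nat a else 0)" if g: "g \<in> carrier G" for g
  proof -
    have "(\<Sum>i<a. \<rho> g $$ (i, i)) = (\<Sum>i<a. if g = \<one> then 1 else 0)"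
    proof (rule sum.cong)
      fix i assume "i \<in> {..<a}"
      then have i: "i < a" by simp
      have "e i = g \<otimes> e i \<longleftrightarrow> g = \<one>"
        using r_cancel_one'[OF ec[OF i] g] by (simp add: eq_commute)
      then show "\<rho> g $$ (i, i) = (if g = \<one> then 1 else 0)" using i by (simp add: \<rho>_def)
    qed simp
    then show ?thesis by simp
  qed
  ultimately show thesis
    using that unfolding a_def by blast
qed

text \<open>The regular trace sees only the coefficient at the identity, and right translation of
  \<open>f\<close> moves the coefficient at \<open>h\<close> there. The translate still annihilates,
  because the entries of \<open>\<sigma> (g \<otimes> inv h)\<close> are combinations of those of
  \<open>\<sigma> g\<close> with coefficients independent of \<open>g\<close>.\<close>

lemma (in group) irreducible_annihilator_zero:
  fixes f :: "'a \<Rightarrow> 'k::field"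
  assumes fin: "finite (carrier G)" and char: "of_nat (card (carrier G)) \<noteq> (0 :: 'k)"
    and ann: "\<And>d (\<sigma> :: 'a \<Rightarrow> 'k mat) p q. irreducible_rep G d \<sigma> \<Longrightarrow> p < d \<Longrightarrow> q < d \<Longrightarrow>
      (\<Sum>g\<in>carrier G. f g * \<sigma> g $$ (p, q)) = 0"
    and h: "h \<in> carrier G"
  shows "f h = 0"
proof -
  define f' where "f' g = f (g \<otimes> h)" for g
  have ann': "(\<Sum>g\<in>carrier G. f' g * \<sigma> g $$ (p, q)) = 0"
    if \<sigma>: "irreducible_rep G d \<sigma>" and pq: "p < d" "q < d" for d and \<sigma> :: "'a \<Rightarrow> 'k mat" and p q
  proof -
    note \<sigma>' = irreducible_repD[OF \<sigma>]
    have "(\<Sum>g\<in>carrier G. f' g * \<sigma> g $$ (p, q)) = (\<Sum>g\<in>carrier G. f g * \<sigma> (g \<otimes> inv h) $$ (p, q))"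
      using h by (intro sum.reindex_bij_witness[of _ "\<lambda>g. g \<otimes> inv h" "\<lambda>g. g \<otimes> h"])
        (auto simp: f'_def m_assoc)
    also have "\<dots> = (\<Sum>g\<in>carrier G. \<Sum>r<d. f g * \<sigma> g $$ (p, r) * \<sigma> (inv h) $$ (r, q))"
    proof (rule sum.cong)
      fix g assume g: "g \<in> carrier G"
      have "\<sigma> (g \<otimes> inv h) $$ (p, q) = (\<Sum>r<d. \<sigma> g $$ (p, r) * \<sigma> (inv h) $$ (r, q))"
        using pq \<sigma>'(2)[OF g] \<sigma>'(2)[of "inv h"] h
        by (simp add: \<sigma>'(4)[OF g] scalar_prod_def atLeast0LessThan)
      then show "f g * \<sigma> (g \<otimes> inv h) $$ (p, q) = (\<Sum>r<d. f g * \<sigma> g $$ (p, r) * \<sigma> (inv h) $$ (r, q))"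
        by (simp add: sum_distrib_left mult.assoc)
    qed simp
    also have "\<dots> = (\<Sum>r<d. (\<Sum>g\<in>carrier G. f g * \<sigma> g $$ (p, r)) * \<sigma> (inv h) $$ (r, q))"
      unfolding sum_distrib_right by (rule sum.swap)
    also have "\<dots> = 0"
      using ann[OF \<sigma>] pq by simp
    finally show ?thesis .
  qed
  obtain \<rho> :: "'a \<Rightarrow> 'k mat" where \<rho>: "matrix_rep G (card (carrier G)) \<rho>"
    and tr: "\<forall>g\<in>carrier G.
      (\<Sum>i<card (carrier G). \<rho> g $$ (i, i)) = (if g = \<one> then of_nat (card (carrier G)) else 0)"
    by (rule regular_rep_exists[OF fin]) blast
  have "0 = (\<Sum>g\<in>carrier G. f' g * (\<Sum>i<card (carrier G). \<rho> g $$ (i, i)))"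
    using trace_combination_zero[OF ann' \<rho>] by simp
  also have "\<dots> = (\<Sum>g\<in>carrier G. if g = \<one> then f' g * of_nat (card (carrier G)) else 0)"
    by (intro sum.cong) (auto simp: tr)
  also have "\<dots> = f h * of_nat (card (carrier G))"
    using fin h by (simp add: f'_def)
  finally show ?thesis using char by simp
qed

section \<open>Orthogonality of matrix coefficients\<close>

text \<open>Over the algebraic closure \<open>T\<close> has an eigenvalue \<open>c\<close>, and
  subtracting \<open>c\<close> times the identity gives an intertwiner with nonzero kernel. Absolute
  irreducibility forces it to be zero.\<close>

lemma (in group) scalar_if_commutes_absolutely_irreducible:
  fixes \<sigma> :: "'a \<Rightarrow> 'k::field mat"
  assumes \<sigma>: "irreducible_rep G n \<sigma>" and abs: "absolutely_irreducible_rep G n \<sigma>"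
    and T: "T \<in> carrier_mat n n" and comm: "\<And>g. g \<in> carrier G \<Longrightarrow> \<sigma> g * T = T * \<sigma> g"
  obtains c where "T = c \<cdot>\<^sub>m 1\<^sub>m n"
proof -
  note \<sigma>' = irreducible_repD[OF \<sigma>]
  define T' :: "'k alg_closure mat" where "T' = map_mat to_ac T"
  define \<sigma>'' :: "'a \<Rightarrow> 'k alg_closure mat" where "\<sigma>'' g = map_mat to_ac (\<sigma> g)" for g
  have irr: "irreducible_rep G n \<sigma>''"
    using abs by (simp add: absolutely_irreducible_rep_def \<sigma>''_def[abs_def])
  have T': "T' \<in> carrier_mat n n" using T by (simp add: T'_def)
  have hom: "map_mat to_ac (A * B) = map_mat to_ac A * map_mat to_ac B"
    if "A \<in> carrier_mat n n" "B \<in> carrier_mat n n" for A B :: "'k mat"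
    using that by (intro eq_matI) (auto simp: scalar_prod_def to_ac_sum)
  have comm': "\<sigma>'' g * T' = T' * \<sigma>'' g" if g: "g \<in> carrier G" for g
    using hom[OF \<sigma>'(2)[OF g] T] hom[OF T \<sigma>'(2)[OF g]] comm[OF g] by (simp add: \<sigma>''_def T'_def)
  have "Polynomial.degree (char_poly T') = n"
    using degree_monic_char_poly[OF T'] by simp
  with \<sigma>'(1) obtain c where "poly (char_poly T') c = 0"
    using alg_closed_imp_poly_has_root[of "char_poly T'"] by auto
  then have "eigenvalue T' c"
    using eigenvalue_root_char_poly[OF T'] by simp
  then obtain v where v: "v \<in> carrier_vec n" "v \<noteq> 0\<^sub>v n" "T' *\<^sub>v v = c \<cdot>\<^sub>v v"
    using T' by (auto simp: eigenvalue_def eigenvector_def)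
  define S where "S = T' - c \<cdot>\<^sub>m 1\<^sub>m n"
  have S: "S \<in> carrier_mat n n" by (auto simp: S_def intro!: minus_carrier_mat)
  have "\<sigma>'' g * S = S * \<sigma>'' g" if g: "g \<in> carrier G" for g
  proof -
    have gc: "\<sigma>'' g \<in> carrier_mat n n" using \<sigma>'(2)[OF g] by (simp add: \<sigma>''_def)
    have "\<sigma>'' g * S = \<sigma>'' g * T' - \<sigma>'' g * (c \<cdot>\<^sub>m 1\<^sub>m n)"
      unfolding S_def using gc T' by (intro mult_minus_distrib_mat) auto
    also have "\<dots> = T' * \<sigma>'' g - (c \<cdot>\<^sub>m 1\<^sub>m n) * \<sigma>'' g"
      using gc comm'[OF g] mult_smult_distrib[OF gc one_carrier_mat, of c]
        mult_smult_assoc_mat[OF one_carrier_mat gc, of c] by simp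
    also have "\<dots> = S * \<sigma>'' g"
      unfolding S_def using gc T' by (intro minus_mult_distrib_mat[symmetric]) auto
    finally show ?thesis .
  qed
  moreover have "S *\<^sub>v v = 0\<^sub>v n"
  proof -
    have "S *\<^sub>v v = T' *\<^sub>v v - c \<cdot>\<^sub>m 1\<^sub>m n *\<^sub>v v"
      unfolding S_def using T' v by (intro minus_mult_distrib_mat_vec) auto
    also have "c \<cdot>\<^sub>m 1\<^sub>m n *\<^sub>v v = c \<cdot>\<^sub>v v"
      using v by (intro eq_vecI) auto
    finally show ?thesis using v by simp
  qed
  moreover have "matrix_rep G n \<sigma>''"
    using irr by (simp add: irreducible_rep_def)
  ultimately have S0: "S = 0\<^sub>m n n"
    using intertwiner_kernel[OF _ irr S _ v(1,2)] by blast
  have T'_entry: "to_ac (T $$ (i, j)) = (if i = j then c else 0)" if ij: "i < n" "j < n" for i j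
  proof -
    have "S $$ (i, j) = 0" unfolding S0 using ij by simp
    then show ?thesis using ij T by (simp add: S_def T'_def split: if_splits)
  qed
  \<comment> \<open>\<open>c\<close> lives in the closure, but it is the image of the entry at
    \<open>(0, 0)\<close>, which exists as \<open>n > 0\<close>; injectivity of \<open>to_ac\<close>
    brings the equation back to the base field.\<close>
  have "T = T $$ (0, 0) \<cdot>\<^sub>m 1\<^sub>m n"
  proof (rule eq_matI)
    fix i j assume "i < dim_row (T $$ (0, 0) \<cdot>\<^sub>m 1\<^sub>m n)" "j < dim_col (T $$ (0, 0) \<cdot>\<^sub>m 1\<^sub>m n)"
    then have ij: "i < n" "j < n" by auto
    have "to_ac (T $$ (i, j)) = to_ac (if i = j then T $$ (0, 0) else 0)"
      using T'_entry[OF ij] T'_entry[OF \<sigma>'(1) \<sigma>'(1)] by simp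
    then show "T $$ (i, j) = (T $$ (0, 0) \<cdot>\<^sub>m 1\<^sub>m n) $$ (i, j)"
      using ij by (simp only: to_ac_eq_iff) simp
  qed (use T in auto)
  then show thesis by (rule that)
qed

text \<open>\<open>T\<close> is the sum over the group of
  \<open>\<sigma> g * U * \<tau> (inv g)\<close>, written by entries, where \<open>U\<close> is the
  matrix unit with its \<open>1\<close> at \<open>(k, l)\<close>. Multiplication by \<open>h\<close>
  only permutes the summands.\<close>

lemma (in group) averaged_unit_intertwines:
  fixes \<sigma> \<tau> :: "'a \<Rightarrow> 'k::field mat"
  assumes \<sigma>: "irreducible_rep G n \<sigma>" and \<tau>: "irreducible_rep G m \<tau>" and kl: "k < n" "l < m"
    and h: "h \<in> carrier G"
  defines "T \<equiv> mat n m (\<lambda>(p, q). \<Sum>g\<in>carrier G. \<sigma> g $$ (p, k) * \<tau> (inv g) $$ (l, q))"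
  shows "\<sigma> h * T = T * \<tau> h"
proof (rule eq_matI)
  note \<sigma>' = irreducible_repD[OF \<sigma>]
  note \<tau>' = irreducible_repD[OF \<tau>]
  note hc = \<sigma>'(2)[OF h] \<tau>'(2)[OF h]
  show "dim_row (\<sigma> h * T) = dim_row (T * \<tau> h)" "dim_col (\<sigma> h * T) = dim_col (T * \<tau> h)"
    using hc by (auto simp: T_def)
  fix p q assume "p < dim_row (T * \<tau> h)" "q < dim_col (T * \<tau> h)"
  then have pq: "p < n" "q < m" using hc by (auto simp: T_def)
  have "(\<sigma> h * T) $$ (p, q) =
    (\<Sum>r<n. \<Sum>g\<in>carrier G. \<sigma> h $$ (p, r) * \<sigma> g $$ (r, k) * \<tau> (inv g) $$ (l, q))"
    using pq hc by (simp add: T_def scalar_prod_def atLeast0LessThan sum_distrib_left mult.assoc)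
  also have "\<dots> = (\<Sum>g\<in>carrier G. (\<Sum>r<n. \<sigma> h $$ (p, r) * \<sigma> g $$ (r, k)) * \<tau> (inv g) $$ (l, q))"
    unfolding sum_distrib_right by (rule sum.swap)
  also have "\<dots> = (\<Sum>g\<in>carrier G. \<sigma> (h \<otimes> g) $$ (p, k) * \<tau> (inv g) $$ (l, q))"
  proof (rule sum.cong)
    fix g assume g: "g \<in> carrier G"
    show "(\<Sum>r<n. \<sigma> h $$ (p, r) * \<sigma> g $$ (r, k)) * \<tau> (inv g) $$ (l, q) =
      \<sigma> (h \<otimes> g) $$ (p, k) * \<tau> (inv g) $$ (l, q)"
      using pq kl hc \<sigma>'(2)[OF g] by (simp add: \<sigma>'(4)[OF h g] scalar_prod_def atLeast0LessThan)
  qed simp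
  \<comment> \<open>Renaming \<open>h \<otimes> g\<close> to \<open>g\<close> turns
    \<open>inv g\<close> into \<open>inv g \<otimes> h\<close>.\<close>
  also have "\<dots> = (\<Sum>g\<in>carrier G. \<sigma> g $$ (p, k) * \<tau> (inv g \<otimes> h) $$ (l, q))"
    using h by (intro sum.reindex_bij_witness[of _ "\<lambda>g. inv h \<otimes> g" "\<lambda>g. h \<otimes> g"])
      (auto simp: inv_mult_group m_assoc simp flip: m_assoc[of "inv h" h] m_assoc[of h "inv h"])
  also have "\<dots> = (\<Sum>g\<in>carrier G. \<Sum>r<m. \<sigma> g $$ (p, k) * \<tau> (inv g) $$ (l, r) * \<tau> h $$ (r, q))"
  proof (rule sum.cong)
    fix g assume g: "g \<in> carrier G"
    show "\<sigma> g $$ (p, k) * \<tau> (inv g \<otimes> h) $$ (l, q) =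
      (\<Sum>r<m. \<sigma> g $$ (p, k) * \<tau> (inv g) $$ (l, r) * \<tau> h $$ (r, q))"
      using pq kl hc \<tau>'(2)[of "inv g"] g
      by (simp add: \<tau>'(4)[OF _ h] scalar_prod_def atLeast0LessThan sum_distrib_left mult.assoc)
  qed simp
  also have "\<dots> = (T * \<tau> h) $$ (p, q)"
    using pq hc by (subst sum.swap) (simp add: T_def scalar_prod_def atLeast0LessThan sum_distrib_right)
  finally show "(\<sigma> h * T) $$ (p, q) = (T * \<tau> h) $$ (p, q)" .
qed

lemma (in group) coefficients_orthogonal_nonisomorphic:
  fixes \<sigma> \<tau> :: "'a \<Rightarrow> 'k::field mat"
  assumes \<sigma>: "irreducible_rep G n \<sigma>" and \<tau>: "irreducible_rep G m \<tau>" and "\<not> isomorphic_rep G \<sigma> \<tau>"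
    and "p < n" "k < n" "l < m" "q < m"
  shows "(\<Sum>g\<in>carrier G. \<sigma> g $$ (p, k) * \<tau> (inv g) $$ (l, q)) = 0"
proof -
  define T where "T = mat n m (\<lambda>(p, q). \<Sum>g\<in>carrier G. \<sigma> g $$ (p, k) * \<tau> (inv g) $$ (l, q))"
  have "T = 0\<^sub>m n m"
  proof (rule ccontr)
    assume "T \<noteq> 0\<^sub>m n m"
    with schur_iso[OF \<sigma> \<tau>, of T] averaged_unit_intertwines[OF \<sigma> \<tau>, of k l] assms(3-)
    show False by (simp add: T_def)
  qed
  then have "T $$ (p, q) = 0" using assms by simp
  then show ?thesis using assms by (simp add: T_def)
qed

text \<open>The averaged matrix unit is now a scalar \<open>c\<close>, and comparing traces
  determines \<open>n * c\<close>. The factor \<open>n\<close> stays on the left, so that the only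
  division made later is by the group order.\<close>

lemma (in group) coefficients_orthogonal_self:
  fixes \<sigma> :: "'a \<Rightarrow> 'k::field mat"
  assumes \<sigma>: "irreducible_rep G n \<sigma>" and abs: "absolutely_irreducible_rep G n \<sigma>"
    and ind: "p < n" "k < n" "l < n" "q < n"
  shows "of_nat n * (\<Sum>g\<in>carrier G. \<sigma> g $$ (p, k) * \<sigma> (inv g) $$ (l, q)) =
    (if p = q \<and> k = l then of_nat (card (carrier G)) else 0)"
proof -
  note \<sigma>' = irreducible_repD[OF \<sigma>]
  define T where "T = mat n n (\<lambda>(p, q). \<Sum>g\<in>carrier G. \<sigma> g $$ (p, k) * \<sigma> (inv g) $$ (l, q))"
  obtain c where c: "T = c \<cdot>\<^sub>m 1\<^sub>m n"
    using scalar_if_commutes_absolutely_irreducible[OF \<sigma> abs, of T]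
      averaged_unit_intertwines[OF \<sigma> \<sigma>, of k l] ind by (auto simp: T_def)
  \<comment> \<open>Each group element contributes to the trace of \<open>T\<close> the entry
    \<open>(l, k)\<close> of \<open>\<sigma> (inv g) * \<sigma> g\<close>, that is, of the
    identity.\<close>
  have "of_nat n * c = (\<Sum>r<n. T $$ (r, r))"
    by (simp add: c)
  also have "\<dots> = (\<Sum>r<n. \<Sum>g\<in>carrier G. \<sigma> (inv g) $$ (l, r) * \<sigma> g $$ (r, k))"
    by (simp add: T_def mult.commute)
  also have "\<dots> = (\<Sum>g\<in>carrier G. \<Sum>r<n. \<sigma> (inv g) $$ (l, r) * \<sigma> g $$ (r, k))"
    by (rule sum.swap)
  also have "\<dots> = (\<Sum>g\<in>carrier G. if k = l then 1 else 0)"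
  proof (rule sum.cong)
    fix g assume g: "g \<in> carrier G"
    have "(\<Sum>r<n. \<sigma> (inv g) $$ (l, r) * \<sigma> g $$ (r, k)) = (\<sigma> (inv g) * \<sigma> g) $$ (l, k)"
      using ind \<sigma>'(2)[OF g] \<sigma>'(2)[of "inv g"] g by (simp add: scalar_prod_def atLeast0LessThan)
    also have "\<sigma> (inv g) * \<sigma> g = 1\<^sub>m n"
      using \<sigma>'(4)[of "inv g" g] g \<sigma>'(3) by simp
    finally show "(\<Sum>r<n. \<sigma> (inv g) $$ (l, r) * \<sigma> g $$ (r, k)) = (if k = l then 1 else 0)"
      using ind by simp
  qed simp
  also have "\<dots> = (if k = l then of_nat (card (carrier G)) else 0)" by simp
  finally have nc: "of_nat n * c = (if k = l then of_nat (card (carrier G)) else 0)" .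
  have "(\<Sum>g\<in>carrier G. \<sigma> g $$ (p, k) * \<sigma> (inv g) $$ (l, q)) = T $$ (p, q)"
    using ind by (simp add: T_def)
  also have "\<dots> = (if p = q then c else 0)"
    using ind by (simp add: c)
  finally show ?thesis using nc by (auto split: if_splits)
qed

section \<open>The degrees: their squares and the trivial module\<close>

lemma (in group) irreducible_trivial_rep:
  "irreducible_rep G 1 (\<lambda>_. 1\<^sub>m 1 :: 'k::field mat)"
  unfolding irreducible_rep_def
proof (intro conjI allI impI)
  show "matrix_rep G 1 (\<lambda>_. 1\<^sub>m 1 :: 'k mat)"
    by (simp add: matrix_rep_iff)
  fix W :: "'k vec set"
  assume "VectorSpace.subspace class_ring W (module_vec TYPE('k) 1) \<and>
    (\<forall>g\<in>carrier G. \<forall>w\<in>W. 1\<^sub>m 1 *\<^sub>v w \<in> W)"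
  then have W: "W \<subseteq> carrier_vec 1" "0\<^sub>v 1 \<in> W" "\<And>c v. v \<in> W \<Longrightarrow> c \<cdot>\<^sub>v v \<in> W"
    unfolding subspace_module_vec_iff by blast+
  show "W = {0\<^sub>v 1} \<or> W = carrier_vec 1"
  proof (cases "W = {0\<^sub>v 1}")
    case False
    with W obtain w where w: "w \<in> W" "w \<noteq> 0\<^sub>v 1" "w \<in> carrier_vec 1" by blast
    have w0: "w $ 0 \<noteq> 0"
      using w(2,3) by (auto simp: vec_eq_iff)
    have "v \<in> W" if v: "v \<in> carrier_vec 1" for v
    proof -
      have "v = (v $ 0 / w $ 0) \<cdot>\<^sub>v w"
        using v w(3) w0 by (intro eq_vecI) auto
      then show ?thesis using W(3)[OF w(1)] by metis
    qed
    with W(1) show ?thesis by blast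
  qed simp
qed simp

text \<open>The entries of \<open>P * M' g * Q\<close> are combinations of the entries of
  \<open>M' g\<close> with coefficients that do not depend on \<open>g\<close>.\<close>

lemma (in group) annihilator_isomorphic_rep:
  fixes M' \<rho> :: "'a \<Rightarrow> 'k::field mat" and f :: "'a \<Rightarrow> 'k"
  assumes M: "irreducible_rep G m M'" and iso: "isomorphic_rep G \<rho> M'"
    and ann: "\<And>p q. p < m \<Longrightarrow> q < m \<Longrightarrow> (\<Sum>g\<in>carrier G. f g * M' g $$ (p, q)) = 0"
    and \<rho>: "irreducible_rep G n \<rho>" and pq: "p < n" "q < n"
  shows "(\<Sum>g\<in>carrier G. f g * \<rho> g $$ (p, q)) = 0"
proof -
  note M' = irreducible_repD[OF M]
  note \<rho>' = irreducible_repD[OF \<rho>]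
  from iso obtain P Q where PQ: "\<And>g. g \<in> carrier G \<Longrightarrow> similar_mat_wit (\<rho> g) (M' g) P Q"
    unfolding isomorphic_rep_def by blast
  note wit = similar_mat_witD2[OF \<rho>'(2) PQ]
  have P: "P \<in> carrier_mat n n" and Q: "Q \<in> carrier_mat n n" and "m = n"
    using wit(5-7)[OF one_closed one_closed] M'(2)[OF one_closed] by auto
  have "(\<Sum>g\<in>carrier G. f g * \<rho> g $$ (p, q)) =
    (\<Sum>g\<in>carrier G. \<Sum>t<n. \<Sum>r<n. P $$ (p, r) * Q $$ (t, q) * (f g * M' g $$ (r, t)))"
  proof (rule sum.cong)
    fix g assume g: "g \<in> carrier G"
    have Mg: "M' g \<in> carrier_mat n n" using wit(5)[OF g g] .
    have "\<rho> g $$ (p, q) = (P * M' g * Q) $$ (p, q)"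
      using wit(3)[OF g g] by simp
    also have "\<dots> = (\<Sum>t<n. (P * M' g) $$ (p, t) * Q $$ (t, q))"
      using pq P Q Mg by (simp add: scalar_prod_def atLeast0LessThan del: assoc_mult_mat)
    also have "\<dots> = (\<Sum>t<n. (\<Sum>r<n. P $$ (p, r) * M' g $$ (r, t)) * Q $$ (t, q))"
      using pq P Mg by (intro sum.cong) (auto simp: scalar_prod_def atLeast0LessThan)
    finally show "f g * \<rho> g $$ (p, q) =
      (\<Sum>t<n. \<Sum>r<n. P $$ (p, r) * Q $$ (t, q) * (f g * M' g $$ (r, t)))"
      by (simp add: sum_distrib_left sum_distrib_right mult_ac)
  qed simp
  also have "\<dots> = (\<Sum>t<n. \<Sum>r<n. \<Sum>g\<in>carrier G. P $$ (p, r) * Q $$ (t, q) * (f g * M' g $$ (r, t)))"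
    by (subst sum.swap, intro sum.cong refl, rule sum.swap)
  also have "\<dots> = 0"
    unfolding sum_distrib_left[symmetric] using ann by (simp add: \<open>m = n\<close>)
  finally show ?thesis .
qed

lemma (in group) sum_squares_degrees:
  fixes M :: "nat \<Rightarrow> 'a \<Rightarrow> 'k::field mat"
  assumes fin: "finite (carrier G)" and split: "splitting_field TYPE('k) G"
    and M: "irreducible_representatives G s d M"
  shows "(\<Sum>i=1..s. (d i)\<^sup>2) = card (carrier G)"
proof -
  let ?a = "of_nat (card (carrier G)) :: 'k"
  have a: "?a \<noteq> 0"
    using split unfolding splitting_field_def of_nat_eq_0_iff_char_dvd by blast
  have irr: "irreducible_rep G (d i) (M i)" if "i \<in> {1..s}" for i
    using M that unfolding irreducible_representatives_def by blast
  have abs: "absolutely_irreducible_rep G (d i) (M i)" if "i \<in> {1..s}" for i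
    using split irr[OF that] unfolding splitting_field_def by blast
  have noniso: "\<not> isomorphic_rep G (M i) (M j)" if "i \<in> {1..s}" "j \<in> {1..s}" "i \<noteq> j" for i j
    using M that unfolding irreducible_representatives_def by blast
  \<comment> \<open>\<open>J\<close> indexes all matrix coefficients by representation, row and
    column.\<close>
  define J where "J = (SIGMA i:{1..s}. {..<d i} \<times> {..<d i})"
  have "finite J" by (simp add: J_def)
  have card_J: "card J = (\<Sum>i=1..s. (d i)\<^sup>2)"
    by (simp add: J_def card_cartesian_product power2_eq_square)
  define F where "F g = (\<lambda>(i, p, k). M i g $$ (p, k))" for g
  \<comment> \<open>By orthogonality the coefficient at \<open>(p, k)\<close> is dual to the one at
    \<open>(k, p)\<close> of the inverse element, scaled by degree over group order. Thus
    \<open>Y\<close> is a left inverse of \<open>F\<close>, which expresses linear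
    independence.\<close>
  define Y where "Y = (\<lambda>(i, p, k) g. of_nat (d i) / ?a * M i (inv g) $$ (k, p))"
  have "card J \<le> card (carrier G)"
  proof (rule card_le_of_left_inverse[OF fin \<open>finite J\<close>])
    fix j j' assume "j \<in> J" "j' \<in> J"
    then obtain i q l i' p k where j: "j = (i, q, l)" "j' = (i', p, k)"
      and mem: "i \<in> {1..s}" "i' \<in> {1..s}" "q < d i" "l < d i" "p < d i'" "k < d i'"
      by (auto simp: J_def)
    have "(\<Sum>g\<in>carrier G. Y j g * F g j') =
      of_nat (d i) / ?a * (\<Sum>g\<in>carrier G. M i' g $$ (p, k) * M i (inv g) $$ (l, q))"
      by (simp add: Y_def F_def j sum_distrib_left mult_ac)
    also have "\<dots> = (if j = j' then 1 else 0)"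
    proof (cases "i = i'")
      case True
      have "of_nat (d i) * (\<Sum>g\<in>carrier G. M i g $$ (p, k) * M i (inv g) $$ (l, q)) =
        (if p = q \<and> k = l then ?a else 0)"
        using mem True by (intro coefficients_orthogonal_self irr abs) auto
      then show ?thesis using True a by (auto simp: j)
    next
      case False
      then have "(\<Sum>g\<in>carrier G. M i' g $$ (p, k) * M i (inv g) $$ (l, q)) = 0"
        using mem by (intro coefficients_orthogonal_nonisomorphic[OF irr irr noniso]) auto
      then show ?thesis using False by (simp add: j)
    qed
    finally show "(\<Sum>g\<in>carrier G. Y j g * F g j') = (if j = j' then 1 else 0)" .
  qed
  \<comment> \<open>With fewer coefficients than group elements, some nonzero \<open>f\<close> would
    annihilate those of all \<open>M i\<close>, hence, by completeness of the list, those of every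
    irreducible representation.\<close>
  moreover have "card (carrier G) \<le> card J"
  proof (rule ccontr)
    assume "\<not> card (carrier G) \<le> card J"
    with nonzero_combination_exists[OF \<open>finite J\<close> fin, of F] obtain f h where
      h: "h \<in> carrier G" "f h \<noteq> 0" and f: "\<And>j. j \<in> J \<Longrightarrow> (\<Sum>g\<in>carrier G. f g * F g j) = 0" by auto
    have "f h = 0"
    proof (rule irreducible_annihilator_zero[OF fin a _ h(1)])
      fix n and \<sigma> :: "'a \<Rightarrow> 'k mat" and p q
      assume \<sigma>: "irreducible_rep G n \<sigma>" and pq: "p < n" "q < n"
      from M \<sigma> obtain i where i: "i \<in> {1..s}" "isomorphic_rep G \<sigma> (M i)"
        unfolding irreducible_representatives_def by blast
      show "(\<Sum>g\<in>carrier G. f g * \<sigma> g $$ (p, q)) = 0"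
      proof (rule annihilator_isomorphic_rep[OF irr[OF i(1)] i(2) _ \<sigma> pq])
        fix p q assume "p < d i" "q < d i"
        then show "(\<Sum>g\<in>carrier G. f g * M i g $$ (p, q)) = 0"
          using f[of "(i, p, q)"] i(1) by (simp add: F_def J_def)
      qed
    qed
    with h show False by simp
  qed
  ultimately show ?thesis by (simp add: card_J)
qed

text \<open>The trivial representation has to be isomorphic to a listed one, which excludes
  \<open>s = 0\<close>. The degree is then read off from the size of \<open>M 1\<close> at the
  identity.\<close>

lemma (in group) representatives_trivial_degree:
  fixes M :: "nat \<Rightarrow> 'a \<Rightarrow> 'k::field mat"
  assumes M: "irreducible_representatives G s d M"
  shows "1 \<in> {1..s}" and "d 1 = 1"
proof -
  have "\<exists>i\<in>{1..s}. isomorphic_rep G (\<lambda>_. 1\<^sub>m 1) (M i)"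
    using M irreducible_trivial_rep unfolding irreducible_representatives_def by blast
  then show "1 \<in> {1..s}" by auto
  then have "irreducible_rep G (d 1) (M 1)" "M 1 \<one> = 1\<^sub>m 1"
    using M one_closed unfolding irreducible_representatives_def by blast+
  from irreducible_repD(3)[OF this(1)] this(2) have "1\<^sub>m (d 1) = (1\<^sub>m 1 :: 'k mat)"
    by simp
  from arg_cong[OF this, of dim_row] show "d 1 = 1" by simp
qed

section \<open>Minimal tuples\<close>

text \<open>The interface between representation theory and arithmetic: the argument on tuples sees
  the group through these facts alone.\<close>

locale degree_sequence =
  fixes s a :: nat and d :: "nat \<Rightarrow> nat"
  assumes one_mem: "1 \<in> {1..s}" and d_one: "d 1 = 1"
    and d_pos: "\<And>i. i \<in> {1..s} \<Longrightarrow> d i > 0"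
    and sum_squares: "(\<Sum>i=1..s. (d i)\<^sup>2) = a"
begin

declare One_nat_def [simp del]

lemma sum_squares_int: "(\<Sum>i=1..s. int (d i) * int (d i)) = int a"
  unfolding sum_squares[symmetric] by (simp add: power2_eq_square)

lemma a_eq: "int a = 1 + (\<Sum>i\<in>{1..s} - {1}. int (d i) * int (d i))"
proof -
  have "(\<Sum>i=1..s. int (d i) * int (d i)) = int (d 1) * int (d 1) + (\<Sum>i\<in>{1..s} - {1}. int (d i) * int (d i))"
    using one_mem by (intro sum.remove) auto
  then show ?thesis unfolding sum_squares_int d_one by simp
qed

lemma a_pos: "a > 0"
proof -
  have "(\<Sum>i\<in>{1..s} - {1}. int (d i) * int (d i)) \<ge> 0" by (intro sum_nonneg) simp
  with a_eq show ?thesis by linarith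
qed

section \<open>Translation by the degree vector\<close>

text \<open>\<open>c\<close> is an integer so that \<open>shift (- c)\<close> can undo the
  translation; the restriction to \<open>{1..s}\<close> keeps tuples \<open>undefined\<close>
  outside, as \<open>admissible\<close> demands.\<close>

definition shift :: "int \<Rightarrow> (nat \<Rightarrow> int) \<Rightarrow> nat \<Rightarrow> int" where
  "shift c t = (\<lambda>i\<in>{1..s}. t i + c * int (d i))"

lemma shift_shift: "t \<in> {1..s} \<rightarrow>\<^sub>E UNIV \<Longrightarrow> shift (- c) (shift c t) = t"
  by (auto simp: shift_def fun_eq_iff PiE_def extensional_def)

lemma sum_shift: "(\<Sum>i=1..s. shift c t i * int (d i)) = (\<Sum>i=1..s. t i * int (d i)) + c * int a"
proof -
  have "(\<Sum>i=1..s. shift c t i * int (d i)) =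
    (\<Sum>i=1..s. t i * int (d i) + c * (int (d i) * int (d i)))"
    by (intro sum.cong) (auto simp: shift_def algebra_simps)
  then show ?thesis by (simp add: sum.distrib sum_squares_int flip: sum_distrib_left)
qed

lemma sum_squares_shift:
  "(\<Sum>i=1..s. (shift c t i)\<^sup>2) = (\<Sum>i=1..s. (t i)\<^sup>2) + 2 * c * (\<Sum>i=1..s. t i * int (d i)) + c\<^sup>2 * int a"
proof -
  have "(\<Sum>i=1..s. (shift c t i)\<^sup>2) =
    (\<Sum>i=1..s. (t i)\<^sup>2 + 2 * c * (t i * int (d i)) + c\<^sup>2 * (int (d i) * int (d i)))"
    by (intro sum.cong) (auto simp: shift_def power2_eq_square algebra_simps)
  then show ?thesis by (simp add: sum.distrib sum_squares_int flip: sum_distrib_left)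
qed

lemma shift_admissible:
  assumes "admissible s d n t" and "int m = int n + c * int a"
  shows "admissible s d m (shift c t)"
  using assms sum_shift[of c t] by (simp add: admissible_def) (simp add: shift_def)

lemma shift_minimal_tuple:
  assumes t: "minimal_tuple s d n t" and m: "int m = int n + c * int a"
  shows "minimal_tuple s d m (shift c t)"
proof -
  have adm: "admissible s d n t"
    and min: "\<And>u. admissible s d n u \<Longrightarrow> (\<Sum>i=1..s. (t i)\<^sup>2) \<le> (\<Sum>i=1..s. (u i)\<^sup>2)"
    using t by (auto simp: minimal_tuple_def is_arg_min_linorder)
  have "(\<Sum>i=1..s. (shift c t i)\<^sup>2) \<le> (\<Sum>i=1..s. (u i)\<^sup>2)" if u: "admissible s d m u" for u
  proof -
    \<comment> \<open>A competitor \<open>u\<close> for \<open>m\<close> is pulled back to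
      \<open>n\<close>; translation by \<open>c\<close> changes both sums of squares by the same
      amount, 2 c n + c^2 a.\<close>
    have u': "admissible s d n (shift (- c) u)"
      using shift_admissible[OF u, of n "- c"] m by simp
    have "shift c (shift (- c) u) = u"
      using shift_shift[of u "- c"] u by (simp add: admissible_def)
    then have "(\<Sum>i=1..s. (u i)\<^sup>2) =
      (\<Sum>i=1..s. (shift (- c) u i)\<^sup>2) + 2 * c * int n + c\<^sup>2 * int a"
      using sum_squares_shift[of c "shift (- c) u"] u' by (simp add: admissible_def)
    moreover have "(\<Sum>i=1..s. (shift c t i)\<^sup>2) = (\<Sum>i=1..s. (t i)\<^sup>2) + 2 * c * int n + c\<^sup>2 * int a"
      using sum_squares_shift[of c t] adm by (simp add: admissible_def)
    ultimately show ?thesis using min[OF u'] by simp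
  qed
  then show ?thesis
    using shift_admissible[OF adm m] by (simp add: minimal_tuple_def is_arg_min_linorder)
qed

lemma card_minimal_tuples_cong:
  assumes "n mod a = m mod a"
  shows "card {t. minimal_tuple s d n t} = card {t. minimal_tuple s d m t}"
proof -
  have "int a dvd int m - int n"
  proof -
    have "int m mod int a = int n mod int a" using assms by (simp flip: zmod_int)
    then show ?thesis by (simp add: mod_eq_dvd_iff)
  qed
  then obtain c where c: "int m = int n + c * int a"
    by (auto simp: dvd_def algebra_simps)
  have "bij_betw (shift c) {t. minimal_tuple s d n t} {t. minimal_tuple s d m t}"
  proof (rule bij_betw_byWitness[where f' = "shift (- c)"])
    have ext: "t \<in> {1..s} \<rightarrow>\<^sub>E UNIV" if "minimal_tuple s d k t" for k t
      using that by (simp add: minimal_tuple_def is_arg_min_def admissible_def)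
    show "\<forall>t\<in>{t. minimal_tuple s d n t}. shift (- c) (shift c t) = t"
      using ext shift_shift[of _ c] by blast
    show "\<forall>t\<in>{t. minimal_tuple s d m t}. shift c (shift (- c) t) = t"
      using ext shift_shift[of _ "- c"] by simp
    show "shift c ` {t. minimal_tuple s d n t} \<subseteq> {t. minimal_tuple s d m t}"
      using shift_minimal_tuple c by blast
    show "shift (- c) ` {t. minimal_tuple s d m t} \<subseteq> {t. minimal_tuple s d n t}"
      using shift_minimal_tuple[where n = m and m = n and c = "- c"] c by auto
  qed
  then show ?thesis by (rule bij_betw_same_card)
qed

text \<open>All minimal tuples share one sum of squares \<open>c\<close>, and an integer is at most
  its square in absolute value, so the entries are bounded by \<open>c\<close>. Finiteness gives the
  count its meaning, since \<open>card\<close> of an infinite set is \<open>0\<close>.\<close>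

lemma finite_minimal_tuples: "finite {t. minimal_tuple s d n t}"
proof (cases "\<exists>u. minimal_tuple s d n u")
  case True
  then obtain u where u: "minimal_tuple s d n u" ..
  define c where "c = (\<Sum>i=1..s. (u i)\<^sup>2)"
  have "{t. minimal_tuple s d n t} \<subseteq> {1..s} \<rightarrow>\<^sub>E {- c..c}"
  proof
    fix t assume "t \<in> {t. minimal_tuple s d n t}"
    then have ext: "t \<in> {1..s} \<rightarrow>\<^sub>E UNIV" and le: "(\<Sum>i=1..s. (t i)\<^sup>2) \<le> c"
      using u by (auto simp: minimal_tuple_def is_arg_min_linorder admissible_def c_def)
    have "t i \<in> {- c..c}" if "i \<in> {1..s}" for i
    proof -
      have "(t i)\<^sup>2 \<le> c"
        using member_le_sum[OF that, of "\<lambda>i. (t i)\<^sup>2"] le by simp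
      moreover have "\<bar>t i\<bar> \<le> (t i)\<^sup>2"
      proof (cases "t i = 0")
        case False
        then have "\<bar>t i\<bar> * 1 \<le> \<bar>t i\<bar> * \<bar>t i\<bar>" by (intro mult_left_mono) auto
        then show ?thesis by (simp add: power2_eq_square)
      qed simp
      ultimately show ?thesis by auto
    qed
    with ext show "t \<in> {1..s} \<rightarrow>\<^sub>E {- c..c}" by (auto simp: PiE_def)
  qed
  then show ?thesis by (rule finite_subset) (simp add: finite_PiE)
qed auto

section \<open>Exchange inequality and eligibility\<close>

text \<open>Trading one unit at position \<open>j\<close> for \<open>d j\<close> units at position
  \<open>1\<close>, or conversely, stays admissible because \<open>d 1 = 1\<close>; by minimality
  neither trade lowers the sum of squares.\<close>

lemma minimal_tuple_exchange:
  assumes t: "minimal_tuple s d n t" and j: "j \<in> {1..s} - {1}"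
  shows "\<bar>2 * (t j - int (d j) * t 1)\<bar> \<le> 1 + int (d j) * int (d j)"
proof -
  let ?R = "{1..s} - {1, j}"
  have split: "(\<Sum>i=1..s. h i) = h 1 + (h j + (\<Sum>i\<in>?R. h i))" for h :: "nat \<Rightarrow> int"
  proof -
    have "{1..s} = insert 1 (insert j ?R)" using j one_mem by auto
    then have "sum h {1..s} = sum h (insert 1 (insert j ?R))" by (rule arg_cong)
    then show ?thesis using j by simp
  qed
  have adm: "admissible s d n t"
    and min: "\<And>u. admissible s d n u \<Longrightarrow> (\<Sum>i=1..s. (t i)\<^sup>2) \<le> (\<Sum>i=1..s. (u i)\<^sup>2)"
    using t by (auto simp: minimal_tuple_def is_arg_min_linorder)
  \<comment> \<open>The sign \<open>e\<close> covers both directions of the trade; the values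
    \<open>1\<close> and \<open>-1\<close> together give the absolute value.\<close>
  have *: "2 * e * (t j - int (d j) * t 1) \<le> 1 + int (d j) * int (d j)" if e: "e * e = 1" for e
  proof -
    define u where "u = t(1 := t 1 + e * int (d j), j := t j - e)"
    have u: "u 1 = t 1 + e * int (d j)" "u j = t j - e"
      using j by (auto simp: u_def)
    have R: "(\<Sum>i\<in>?R. h (u i) i) = (\<Sum>i\<in>?R. h (t i) i)" for h :: "int \<Rightarrow> nat \<Rightarrow> int"
      by (intro sum.cong) (auto simp: u_def)
    have "(\<Sum>i=1..s. u i * int (d i)) = (\<Sum>i=1..s. t i * int (d i))"
      using R[of "\<lambda>x i. x * int (d i)"] unfolding split u by (simp add: d_one algebra_simps)
    then have "admissible s d n u"
      using adm j one_mem by (auto simp: admissible_def u_def PiE_def extensional_def)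
    from min[OF this] have "(t 1)\<^sup>2 + (t j)\<^sup>2 \<le> (t 1 + e * int (d j))\<^sup>2 + (t j - e)\<^sup>2"
      using R[of "\<lambda>x i. x\<^sup>2"] unfolding split u by simp
    moreover have "(t 1 + e * int (d j))\<^sup>2 + (t j - e)\<^sup>2 = (t 1)\<^sup>2 + (t j)\<^sup>2
      - 2 * e * (t j - int (d j) * t 1) + (e * e) * (1 + int (d j) * int (d j))"
      by (simp add: power2_eq_square algebra_simps)
    ultimately show ?thesis using e by simp
  qed
  show ?thesis using *[of 1] *[of "-1"] by simp
qed

text \<open>The first degree already contributes \<open>1\<close> to the sum of squares, so even the
  square of \<open>d j\<close> is at most \<open>a - 1\<close>.\<close>

lemma degree_le:
  assumes "j \<in> {1..s} - {1}"
  shows "int (d j) \<le> int a - 1"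
proof -
  have "int (d j) * int (d j) \<le> int a - 1"
    using member_le_sum[OF assms, of "\<lambda>i. int (d i) * int (d i)"] a_eq by simp
  moreover have "int (d j) \<le> int (d j) * int (d j)"
    using d_pos[of j] assms by simp
  ultimately show ?thesis by linarith
qed

lemma minimal_tuple_eligible:
  assumes t: "minimal_tuple s d n t" and n: "n \<ge> a * (a - 1)"
  shows "eligible s d n t"
proof -
  let ?R = "{1..s} - {1}"
  have adm: "admissible s d n t"
    using t by (auto simp: minimal_tuple_def is_arg_min_def)
  have n': "int n \<ge> int a * (int a - 1)"
  proof -
    have "int (a * (a - 1)) \<le> int n" using n by (simp only: of_nat_le_iff)
    moreover have "int (a - 1) = int a - 1" using a_pos by linarith
    ultimately show ?thesis by simp
  qed
  \<comment> \<open>The upper half of the exchange bound, weakened by 1 + x^2 \<le> x a for x =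
    \<open>d i\<close>, which follows from x + 1 \<le> a and x \<ge> 1. After multiplication by
    \<open>d i\<close> the right side is a fixed factor times the square of \<open>d i\<close>, and
    these squares sum to \<open>a - 1\<close>.\<close>
  have term_le: "2 * (t i * int (d i)) \<le> (2 * t 1 + int a) * (int (d i) * int (d i))" if i: "i \<in> ?R" for i
  proof -
    have D: "int (d i) > 0" "int (d i) + 1 \<le> int a" using d_pos[of i] degree_le[OF i] i by auto
    have "int (d i) * (int (d i) + 1) \<le> int (d i) * int a"
      using D by (intro mult_left_mono) auto
    then have "1 + int (d i) * int (d i) \<le> int (d i) * int a"
      using D by (simp add: algebra_simps)
    then have "2 * t i \<le> 2 * int (d i) * t 1 + int (d i) * int a"
      using minimal_tuple_exchange[OF t i] by (simp add: algebra_simps abs_le_iff)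
    from mult_right_mono[OF this, of "int (d i)"] show ?thesis by (simp add: algebra_simps)
  qed
  have "2 * int n = 2 * t 1 + (\<Sum>i\<in>?R. 2 * (t i * int (d i)))"
    using adm sum.remove[of "{1..s}" 1 "\<lambda>i. t i * int (d i)"] one_mem
    by (simp add: admissible_def d_one sum_distrib_left)
  also have "\<dots> \<le> 2 * t 1 + (\<Sum>i\<in>?R. (2 * t 1 + int a) * (int (d i) * int (d i)))"
    by (intro add_left_mono sum_mono term_le)
  also have "\<dots> = 2 * t 1 + (2 * t 1 + int a) * (int a - 1)"
    using a_eq by (simp flip: sum_distrib_left)
  also have "\<dots> = int a * (2 * t 1 + (int a - 1))"
    by (simp add: algebra_simps)
  \<comment> \<open>The threshold \<open>a * (a - 1)\<close> enters here: cancelling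
    \<open>a\<close> leaves the lower bound on \<open>t 1\<close>.\<close>
  finally have "int a * (2 * (int a - 1)) \<le> int a * (2 * t 1 + (int a - 1))"
    using n' by (simp add: algebra_simps)
  then have t1: "int a - 1 \<le> 2 * t 1"
    using a_pos by simp
  have "t j \<ge> 0" if j: "j \<in> {1..s}" for j
  proof (cases "j = 1")
    case True
    have "t 1 \<ge> 0" using t1 a_pos by linarith
    with True show ?thesis by simp
  next
    case False
    with j have j': "j \<in> ?R" by simp
    \<comment> \<open>In the lower half of the exchange bound, d j \<le> a - 1 \<le> 2 t 1 absorbs
      the square of \<open>d j\<close>. What remains is 2 t j \<ge> -1, and integrality gives the
      claim.\<close>
    have "int (d j) * int (d j) \<le> int (d j) * (2 * t 1)"
      using degree_le[OF j'] t1 by (intro mult_left_mono) auto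
    then have "2 * t j \<ge> - 1"
      using minimal_tuple_exchange[OF t j'] by (simp add: algebra_simps abs_le_iff)
    then show ?thesis by linarith
  qed
  with adm show ?thesis by (simp add: eligible_def)
qed

end

theorem mainTheorem3:
  fixes A :: "('g, 'm) monoid_scheme"
    and M :: "nat \<Rightarrow> 'g \<Rightarrow> 'k::field mat"
    and d :: "nat \<Rightarrow> nat"
    and s a :: nat
  assumes "group A" and "finite (carrier A)" and "card (carrier A) = a"
    and "splitting_field TYPE('k) A"
    and "irreducible_representatives A s d M"
  shows "(\<forall>n t. n \<ge> a * (a - 1) \<and> minimal_tuple s d n t \<longrightarrow> eligible s d n t) \<and>
         (\<forall>n. n \<ge> a * (a - 1) \<longrightarrow> finite {t. minimal_tuple s d n t}) \<and>
         (\<forall>n m. n \<ge> a * (a - 1) \<and> m \<ge> a * (a - 1) \<and> n mod a = m mod a \<longrightarrow>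
                card {t. minimal_tuple s d n t} = card {t. minimal_tuple s d m t})"
proof -
  interpret group A by fact
  note M = \<open>irreducible_representatives A s d M\<close>
  interpret degree_sequence s a d
  proof
    show "d i > 0" if "i \<in> {1..s}" for i
      using M that unfolding irreducible_representatives_def irreducible_rep_def by blast
    show "(\<Sum>i=1..s. (d i)\<^sup>2) = a"
      using sum_squares_degrees[OF assms(2,4) M] assms(3) by simp
  qed (fact representatives_trivial_degree[OF M])+
  show ?thesis
    using minimal_tuple_eligible finite_minimal_tuples card_minimal_tuples_cong by blast
qed

end
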